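(* Let $H\in(\tfrac12,1)$, $T>0$, $x_0,y_0\in\mathbb{R}^d$, and let $b:\mathbb{R}^d\to\mathbb{R}^d$ satisfy $|b(x_1)-b(x_2)|\le L|x_1-x_2|$ for all $x_1,x_2\in\mathbb{R}^d$ and some constant $L>0$. For $0\le\alpha<1$ and $0<\mu\le 1$, let $X^\mu$ be the solution on $[0,T]$ of $$\mu\ddot X^\mu(t)+\dot X^\mu(t)=b(X^\mu(t))+\mu^\alpha\dot B^H(t),\qquad X^\mu(0)=x_0,\ \dot X^\mu(0)=y_0,$$ and let $\bar X^\mu$ be the solution on $[0,T]$ of $$\dot{\bar X}^\mu(t)=b(\bar X^\mu(t))+\mu^\alpha\dot B^H(t),\qquad \bar X^\mu(0)=x_0.$$ (i) If $0<\alpha<1$, then there is a constant $C>0$, independent of $\mu$, such that $$\mathbb{E}\sup_{0\le t\le T}|X^\mu(t)-\bar X^\mu(t)|\le C\mu^\alpha .$$ (ii) If $\alpha=0$, then $$\lim_{\mu\to0}\ \sup_{0\le t\le T}\mathbb{E}|X^\mu(t)-\bar X^\mu(t)|=0 .$$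
   Context: $B^H$ is a $d$-dimensional fractional Brownian motion with Hurst parameter $H\in(\frac12,1)$ on a complete filtered probability space $(\Omega,\mathscr F,(\mathscr F_t)_{0\le t\le T},\mathbb P)$ satisfying the usual conditions; $T\in(0,\infty)$ is fixed. $\dot B^H$ is a formal derivative: the first equation means the system $dX^\mu=Y^\mu dt$, $dY^\mu=\mu^{-1}[-Y^\mu+b(X^\mu)]dt+\mu^{\alpha-1}dB^H$, $X^\mu(0)=x_0$, $Y^\mu(0)=y_0$, and the second means $\bar X^\mu(t)=x_0+\int_0^t b(\bar X^\mu(s))ds+\mu^\alpha B^H(t)$. Integrals of deterministic functions against $B^H$ are pathwise Young integrals. *)

theory Defs
  imports "HOL-Probability.Probability"
begin

locale usual_filtered_prob_space = prob_space M + complete_measure M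
  for M :: "'w measure" +
  fixes F :: "real \<Rightarrow> 'w measure" and T :: real
  assumes subalgebra_F: "\<And>t. t \<in> {0..T} \<Longrightarrow> subalgebra M (F t)"
    and mono_F: "\<And>s t. 0 \<le> s \<Longrightarrow> s \<le> t \<Longrightarrow> t \<le> T \<Longrightarrow> sets (F s) \<subseteq> sets (F t)"
    and null_sets_F: "null_sets M \<subseteq> sets (F 0)"
    and right_continuous_F: "\<And>t. 0 \<le> t \<Longrightarrow> t < T \<Longrightarrow> sets (F t) = (\<Inter>s\<in>{t<..T}. sets (F s))"

definition adapted_process ::
  "(real \<Rightarrow> 'w measure) \<Rightarrow> real \<Rightarrow> (real \<Rightarrow> 'w \<Rightarrow> 'a::topological_space) \<Rightarrow> bool" where
  "adapted_process F T Z \<longleftrightarrow> (\<forall>t\<in>{0..T}. Z t \<in> borel_measurable (F t))"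

text \<open>Almost sure continuity of the paths on \<open>[0, T]\<close>.\<close>
definition continuous_process ::
  "'w measure \<Rightarrow> real \<Rightarrow> (real \<Rightarrow> 'w \<Rightarrow> 'a::topological_space) \<Rightarrow> bool" where
  "continuous_process M T Z \<longleftrightarrow> (AE w in M. continuous_on {0..T} (\<lambda>t. Z t w))"

text \<open>Gaussian variables may be degenerate (almost surely constant); this is needed below, e.g.
  for the value of a fractional Brownian motion at time \<open>0\<close> or for a trivial linear combination.\<close>
definition gaussian_variable :: "'w measure \<Rightarrow> ('w \<Rightarrow> real) \<Rightarrow> bool" where
  "gaussian_variable M Z \<longleftrightarrow>
     (\<exists>m \<sigma>. 0 < \<sigma> \<and> distributed M lborel Z (normal_density m \<sigma>)) \<or>
     (Z \<in> borel_measurable M \<and> (\<exists>m. AE w in M. Z w = m))"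

definition gaussian_process :: "'w measure \<Rightarrow> real set \<Rightarrow> (real \<Rightarrow> 'w \<Rightarrow> real) \<Rightarrow> bool" where
  "gaussian_process M I W \<longleftrightarrow>
     (\<forall>J c. finite J \<longrightarrow> J \<subseteq> I \<longrightarrow> gaussian_variable M (\<lambda>w. \<Sum>t\<in>J. c t * W t w))"

definition real_fbm :: "'w measure \<Rightarrow> real \<Rightarrow> real \<Rightarrow> (real \<Rightarrow> 'w \<Rightarrow> real) \<Rightarrow> bool" where
  "real_fbm M T H W \<longleftrightarrow>
     gaussian_process M {0..T} W \<and>
     (\<forall>t\<in>{0..T}. (\<integral>w. W t w \<partial>M) = 0) \<and>
     (\<forall>s\<in>{0..T}. \<forall>t\<in>{0..T}. (\<integral>w. W s w * W t w \<partial>M) =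
        (s powr (2 * H) + t powr (2 * H) - \<bar>t - s\<bar> powr (2 * H)) / 2) \<and>
     (AE w in M. W 0 w = 0) \<and>
     continuous_process M T W"

text \<open>The components of a \<open>d\<close>-dimensional fractional Brownian motion are independent as processes,
  that is, as random elements of the product space of real-valued functions on \<open>[0, T]\<close>.\<close>
definition fbm ::
  "'w measure \<Rightarrow> (real \<Rightarrow> 'w measure) \<Rightarrow> real \<Rightarrow> real \<Rightarrow> (real \<Rightarrow> 'w \<Rightarrow> real ^ 'd) \<Rightarrow> bool" where
  "fbm M F T H B \<longleftrightarrow>
     adapted_process F T B \<and>
     (\<forall>i. real_fbm M T H (\<lambda>t w. B t w $ i)) \<and>
     prob_space.indep_vars M (\<lambda>_. PiM {0..T} (\<lambda>_. borel))
       (\<lambda>i w. \<lambda>t\<in>{0..T}. B t w $ i) UNIV"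

text \<open>The noise is additive, so the Young integral \<open>\<integral>\<^sub>0\<^sup>t dB\<close> is \<open>B t - B 0\<close>, which is almost surely \<open>B t\<close>.\<close>
definition second_order_solution ::
  "'w measure \<Rightarrow> (real \<Rightarrow> 'w measure) \<Rightarrow> real \<Rightarrow> (real \<Rightarrow> 'w \<Rightarrow> real ^ 'd) \<Rightarrow>
   (real ^ 'd \<Rightarrow> real ^ 'd) \<Rightarrow> real \<Rightarrow> real ^ 'd \<Rightarrow> real ^ 'd \<Rightarrow> real \<Rightarrow>
   (real \<Rightarrow> 'w \<Rightarrow> real ^ 'd) \<Rightarrow> (real \<Rightarrow> 'w \<Rightarrow> real ^ 'd) \<Rightarrow> bool" where
  "second_order_solution M F T B b \<alpha> x0 y0 \<mu> X Y \<longleftrightarrow>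
     adapted_process F T X \<and> adapted_process F T Y \<and>
     continuous_process M T X \<and> continuous_process M T Y \<and>
     (AE w in M. \<forall>t\<in>{0..T}.
        X t w = x0 + integral {0..t} (\<lambda>s. Y s w) \<and>
        Y t w = y0 + (1 / \<mu>) *\<^sub>R integral {0..t} (\<lambda>s. - Y s w + b (X s w))
                   + \<mu> powr (\<alpha> - 1) *\<^sub>R B t w)"

definition first_order_solution ::
  "'w measure \<Rightarrow> (real \<Rightarrow> 'w measure) \<Rightarrow> real \<Rightarrow> (real \<Rightarrow> 'w \<Rightarrow> real ^ 'd) \<Rightarrow>
   (real ^ 'd \<Rightarrow> real ^ 'd) \<Rightarrow> real \<Rightarrow> real ^ 'd \<Rightarrow> real \<Rightarrow> (real \<Rightarrow> 'w \<Rightarrow> real ^ 'd) \<Rightarrow> bool" where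
  "first_order_solution M F T B b \<alpha> x0 \<mu> Z \<longleftrightarrow>
     adapted_process F T Z \<and> continuous_process M T Z \<and>
     (AE w in M. \<forall>t\<in>{0..T}.
        Z t w = x0 + integral {0..t} (\<lambda>s. b (Z s w)) + \<mu> powr \<alpha> *\<^sub>R B t w)"

end

theory Submission
  imports Defs
begin

text \<open>
  Let \<open>h = \<mu> powr \<alpha> *\<^sub>R B\<close> along a fixed path and let \<open>v = \<mu> Y\<close> be the momentum. Integrating the
  velocity equation gives \<open>X t = x0 + \<integral> b (X s) ds + h t - (v t - \<mu> y0)\<close>, which is the equation for
  \<open>Xbar\<close> up to the change of momentum. By Gronwall's inequality the distance between the two solutions
  is controlled by the supremum of the momentum. Solving the linear equation for \<open>v\<close> gives
  \<open>v t = exp (- t / \<mu>) \<mu> y0 + \<integral> exp (- (t - s) / \<mu>) b (X s) ds + D t\<close>, where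
  \<open>D t = h t - (1 / \<mu>) \<integral> exp (- (t - s) / \<mu>) h s ds\<close>. The first two terms are of order \<open>\<mu>\<close>, so that
  everything depends on \<open>D\<close>, the deviation of the noise from its exponential average over the last
  \<open>\<mu>\<close> units of time. The pathwise part is completed by \<open>relaxation_error_le\<close> (if \<open>h\<close> has the affine
  modulus of continuity \<open>\<omega> + \<kappa> r\<close>, then \<open>D\<close> is at most \<open>\<omega> + \<kappa> \<mu>\<close>) and by
  \<open>small_mass_limit_pathwise\<close>.

  The modulus of continuity comes from dyadic chaining. If \<open>R n\<close> denotes the sum of the dyadic square
  variations of \<open>B\<close> over all levels from \<open>n\<close> on, then \<open>B\<close> oscillates by at most \<open>2 R n\<close> on
  intervals of length \<open>T / 2 ^ n\<close>, hence has the affine modulus with \<open>\<omega> = 2 R n\<close> and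
  \<open>\<kappa> = 2 * 2 ^ n R 0 / T\<close>. The increments of fractional Brownian motion have mean square proportional
  to \<open>\<bar>t - s\<bar> powr (2 * H)\<close>, and \<open>2 * H > 1\<close> is exactly what second moments require for the expectation of
  \<open>R n\<close> to be finite and to decay geometrically in \<open>n\<close> (\<open>expected_chaining_bound\<close>).

  For \<open>\<alpha> > 0\<close> the crude estimate \<open>D \<le> 2 \<mu> powr \<alpha> R 0\<close> suffices, and taking expectations gives the rate
  \<open>\<mu> powr \<alpha>\<close>. For \<open>\<alpha> = 0\<close> the expected error is of order \<open>E (R n) + 2 ^ n \<mu>\<close> for every \<open>n\<close>; it
  tends to \<open>0\<close> when \<open>n\<close> is chosen first and \<open>\<mu>\<close> afterwards.
\<close>

section \<open>Linear relaxation and Gronwall's inequality\<close>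

text \<open>The factor \<open>exp (- c * t)\<close> turns the right-hand side of the hypothesis into a nonincreasing
  function of \<open>t\<close>, whose value at \<open>0\<close> is \<open>a\<close>.\<close>

lemma gronwall_integral:
  fixes u :: "real \<Rightarrow> real"
  assumes "0 < c" and cont: "continuous_on {0..T} u"
    and le: "\<And>t. t \<in> {0..T} \<Longrightarrow> u t \<le> a + c * integral {0..t} u"
    and t: "t \<in> {0..T}"
  shows "u t \<le> a * exp (c * t)"
proof -
  define I where "I = (\<lambda>s. integral {0..s} u)"
  define p where "p = (\<lambda>s. exp (- c * s) * (a + c * I s))"
  have dI: "(I has_real_derivative u s) (at s within {0..T})" if "s \<in> {0..T}" for s
    unfolding I_def using integral_has_real_derivative[OF cont that] .
  have dp: "(p has_real_derivative exp (- c * s) * (c * (u s - (a + c * I s)))) (at s within {0..T})"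
    if "s \<in> {0..T}" for s
    unfolding p_def by (rule derivative_eq_intros dI[OF that] | simp add: algebra_simps)+
  have "p t \<le> p 0"
  proof (rule DERIV_nonpos_imp_decreasing_open[of 0 t p])
    show "0 \<le> t" using t by simp
    show "\<exists>y. (p has_real_derivative y) (at s) \<and> y \<le> 0" if "0 < s" "s < t" for s
    proof (intro exI conjI)
      have "s \<in> {0..T}" "s \<in> interior {0..T}" using that t by (auto simp: interior_atLeastAtMost_real)
      then show "(p has_real_derivative exp (- c * s) * (c * (u s - (a + c * I s)))) (at s)"
        using dp[of s] at_within_interior[of s "{0..T}"] by simp
      have "u s \<le> a + c * I s" using le[of s] \<open>s \<in> {0..T}\<close> by (simp add: I_def)
      then show "exp (- c * s) * (c * (u s - (a + c * I s))) \<le> 0"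
        using \<open>0 < c\<close> by (simp add: mult_le_0_iff)
    qed
    show "continuous_on {0..t} p"
      using t by (auto intro!: DERIV_continuous_on DERIV_subset[OF dp])
  qed
  then have "exp (c * t) * (exp (- c * t) * (a + c * I t)) \<le> exp (c * t) * a"
    by (simp add: p_def I_def)
  then have "a + c * I t \<le> a * exp (c * t)"
    by (simp add: mult.assoc[symmetric] exp_add[symmetric] mult.commute)
  then show ?thesis using le[OF t] by (simp add: I_def)
qed

text \<open>The forcing \<open>h\<close> is only continuous, so the equation cannot be differentiated as it stands. The
  difference \<open>U = v - h\<close> is continuously differentiable and satisfies \<open>U' = f - (U + h) / \<mu>\<close>; the
  integrating factor solves this equation. When \<open>h 0 = 0\<close>, the last bracket is the Young integral
  \<open>\<integral> exp (- (t - s) / \<mu>) dh s\<close> after integration by parts.\<close>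

lemma variation_of_constants:
  fixes v f h :: "real \<Rightarrow> 'a::banach"
  assumes "0 < \<mu>"
    and cv: "continuous_on {0..T} v" and cf: "continuous_on {0..T} f"
    and ch: "continuous_on {0..T} h"
    and eq: "\<And>t. t \<in> {0..T} \<Longrightarrow> v t = v0 + integral {0..t} (\<lambda>s. f s - (1 / \<mu>) *\<^sub>R v s) + h t"
    and t: "t \<in> {0..T}"
  shows "v t = exp (- t / \<mu>) *\<^sub>R v0 + integral {0..t} (\<lambda>s. exp (- (t - s) / \<mu>) *\<^sub>R f s)
           + (h t - (1 / \<mu>) *\<^sub>R integral {0..t} (\<lambda>s. exp (- (t - s) / \<mu>) *\<^sub>R h s))"
proof -
  define U where "U = (\<lambda>s. v0 + integral {0..s} (\<lambda>r. f r - (1 / \<mu>) *\<^sub>R v r))"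
  define k where "k = (\<lambda>s. exp (- (t - s) / \<mu>))"
  have vU: "v s = U s + h s" if "s \<in> {0..T}" for s using eq[OF that] by (simp add: U_def)
  have "continuous_on {0..T} (\<lambda>r. f r - (1 / \<mu>) *\<^sub>R v r)"
    by (intro continuous_intros cf cv)
  from integral_has_vector_derivative[OF this]
  have dU: "(U has_vector_derivative f s - (1 / \<mu>) *\<^sub>R v s) (at s within {0..T})" if "s \<in> {0..T}" for s
    unfolding U_def using has_vector_derivative_add[OF has_vector_derivative_const] that by fastforce
  have dk: "(k has_vector_derivative k s / \<mu>) (at s within A)" for s A
    unfolding k_def has_real_derivative_iff_has_vector_derivative[symmetric]
    using \<open>0 < \<mu>\<close> by (auto intro!: derivative_eq_intros)
  have "((\<lambda>s. k s *\<^sub>R U s) has_vector_derivative k s *\<^sub>R (f s - (1 / \<mu>) *\<^sub>R h s)) (at s within {0..t})"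
    if "s \<in> {0..t}" for s
  proof -
    have s: "s \<in> {0..T}" using that t by auto
    have "((\<lambda>s. k s *\<^sub>R U s) has_vector_derivative
        k s *\<^sub>R (f s - (1 / \<mu>) *\<^sub>R v s) + (k s / \<mu>) *\<^sub>R U s) (at s within {0..T})"
      by (rule has_vector_derivative_scaleR[OF _ dU[OF s]])
         (use dk in \<open>simp add: has_real_derivative_iff_has_vector_derivative\<close>)
    moreover have "k s *\<^sub>R (f s - (1 / \<mu>) *\<^sub>R v s) + (k s / \<mu>) *\<^sub>R U s = k s *\<^sub>R (f s - (1 / \<mu>) *\<^sub>R h s)"
      by (simp add: vU[OF s] algebra_simps)
    ultimately show ?thesis
      using t by (auto intro: has_vector_derivative_within_subset)
  qed
  then have "((\<lambda>s. k s *\<^sub>R (f s - (1 / \<mu>) *\<^sub>R h s)) has_integral k t *\<^sub>R U t - k 0 *\<^sub>R U 0) {0..t}"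
    using t by (intro fundamental_theorem_of_calculus) auto
  then have 1: "U t = exp (- t / \<mu>) *\<^sub>R v0 + integral {0..t} (\<lambda>s. k s *\<^sub>R (f s - (1 / \<mu>) *\<^sub>R h s))"
    by (simp add: integral_unique k_def U_def)
  have c: "continuous_on {0..t} (\<lambda>s. k s *\<^sub>R f s)" "continuous_on {0..t} (\<lambda>s. k s *\<^sub>R h s)"
    unfolding k_def using t \<open>0 < \<mu>\<close>
    by (auto intro!: continuous_intros continuous_on_subset[OF cf] continuous_on_subset[OF ch])
  have "integral {0..t} (\<lambda>s. k s *\<^sub>R (f s - (1 / \<mu>) *\<^sub>R h s))
      = integral {0..t} (\<lambda>s. k s *\<^sub>R f s - (1 / \<mu>) *\<^sub>R (k s *\<^sub>R h s))"
    by (simp add: algebra_simps)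
  also have "\<dots> = integral {0..t} (\<lambda>s. k s *\<^sub>R f s) - (1 / \<mu>) *\<^sub>R integral {0..t} (\<lambda>s. k s *\<^sub>R h s)"
    unfolding integral_cmul[symmetric]
    by (intro integral_diff integrable_continuous_real c continuous_on_scaleR continuous_on_const)
  finally show ?thesis using 1 vU[OF t] by (simp add: k_def)
qed

text \<open>The relaxation kernel at rate \<open>1 / \<mu>\<close> has total mass at most \<open>\<mu>\<close> and mean lag of order
  \<open>\<mu>\<close>; an affine integrand shows both at once, with an explicit primitive.\<close>

lemma exponential_kernel_has_integral:
  fixes \<mu> :: real
  assumes "0 < \<mu>" and "0 \<le> t"
  shows "((\<lambda>s. exp (- (t - s) / \<mu>) * (\<omega> + \<kappa> * (t - s))) has_integral
      \<mu> * (\<omega> + \<kappa> * \<mu>) - \<mu> * (exp (- t / \<mu>) * (\<omega> + \<kappa> * t + \<kappa> * \<mu>))) {0..t}"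
proof -
  define k where "k = (\<lambda>s. exp (- (t - s) / \<mu>))"
  have dk: "(k has_real_derivative k s / \<mu>) (at s within A)" for s A
    unfolding k_def using \<open>0 < \<mu>\<close> by (auto intro!: derivative_eq_intros)
  have dw: "((\<lambda>s. \<omega> + \<kappa> * (t - s) + \<kappa> * \<mu>) has_real_derivative - \<kappa>) (at s within A)" for s A
    by (auto intro!: derivative_eq_intros)
  have "((\<lambda>s. \<mu> * (k s * (\<omega> + \<kappa> * (t - s) + \<kappa> * \<mu>))) has_vector_derivative
      k s * (\<omega> + \<kappa> * (t - s))) (at s within {0..t})" for s
  proof -
    have "((\<lambda>s. \<mu> * (k s * (\<omega> + \<kappa> * (t - s) + \<kappa> * \<mu>))) has_real_derivative
        \<mu> * (k s / \<mu> * (\<omega> + \<kappa> * (t - s) + \<kappa> * \<mu>) + k s * (- \<kappa>))) (at s within {0..t})"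
      by (rule DERIV_cong[OF DERIV_cmult[OF DERIV_mult[OF dk dw]]]) simp
    moreover have "\<mu> * (k s / \<mu> * (\<omega> + \<kappa> * (t - s) + \<kappa> * \<mu>) + k s * (- \<kappa>)) = k s * (\<omega> + \<kappa> * (t - s))"
      using \<open>0 < \<mu>\<close> by (simp add: distrib_left algebra_simps)
    ultimately show ?thesis by (simp add: has_real_derivative_iff_has_vector_derivative)
  qed
  from fundamental_theorem_of_calculus[OF \<open>0 \<le> t\<close> this]
  show ?thesis by (simp add: k_def)
qed

text \<open>The response of the velocity to the noise is \<open>h\<close> minus its exponential average over the recent
  past. Since the averaging kernel forgets on the time scale \<open>\<mu>\<close>, an affine modulus of continuity
  is, in effect, evaluated at lag \<open>\<mu>\<close>. The kernel has mass \<open>1 - exp (- t / \<mu>)\<close> only, and the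
  missing mass is carried by the value \<open>h 0 = 0\<close>; with the exact integral of
  the kernel against the modulus, the boundary terms at \<open>0\<close> cancel except for one of favourable sign.\<close>

lemma relaxation_error_le:
  fixes h :: "real \<Rightarrow> 'a::banach"
  assumes "0 < \<mu>" and "0 \<le> \<kappa>" and "0 \<le> t" and ch: "continuous_on {0..t} h"
    and mod: "\<And>s. s \<in> {0..t} \<Longrightarrow> norm (h t - h s) \<le> \<omega> + \<kappa> * (t - s)"
    and h0: "h 0 = 0"
  shows "norm (h t - (1 / \<mu>) *\<^sub>R integral {0..t} (\<lambda>s. exp (- (t - s) / \<mu>) *\<^sub>R h s)) \<le> \<omega> + \<kappa> * \<mu>"
proof -
  define k where "k = (\<lambda>s. exp (- (t - s) / \<mu>))"
  have dk: "(k has_real_derivative k s / \<mu>) (at s within A)" for s A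
    unfolding k_def using \<open>0 < \<mu>\<close> by (auto intro!: derivative_eq_intros)
  have ck: "continuous_on A k" for A by (rule DERIV_continuous_on[OF dk])
  have ik: "(k has_integral \<mu> - \<mu> * k 0) {0..t}"
    using exponential_kernel_has_integral[OF \<open>0 < \<mu>\<close> \<open>0 \<le> t\<close>, of 1 0] by (simp add: k_def)
  have iw: "((\<lambda>s. k s * (\<omega> + \<kappa> * (t - s))) has_integral
      \<mu> * (\<omega> + \<kappa> * \<mu>) - \<mu> * (k 0 * (\<omega> + \<kappa> * t + \<kappa> * \<mu>))) {0..t}"
    using exponential_kernel_has_integral[OF \<open>0 < \<mu>\<close> \<open>0 \<le> t\<close>] by (simp add: k_def)
  have ch': "continuous_on {0..t} (\<lambda>s. k s *\<^sub>R h s)" by (intro continuous_intros ck ch)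
  have ct: "continuous_on {0..t} (\<lambda>s. k s *\<^sub>R (h t - h s))" by (intro continuous_intros ck ch)
  have "integral {0..t} (\<lambda>s. k s *\<^sub>R (h t - h s))
      = integral {0..t} (\<lambda>s. k s *\<^sub>R h t) - integral {0..t} (\<lambda>s. k s *\<^sub>R h s)"
    unfolding scaleR_diff_right
    by (intro integral_diff integrable_continuous_real ch' continuous_intros ck)
  also have "integral {0..t} (\<lambda>s. k s *\<^sub>R h t) = (\<mu> - \<mu> * k 0) *\<^sub>R h t"
    by (rule integral_unique) (rule has_integral_scaleR_left[OF ik])
  finally have split: "integral {0..t} (\<lambda>s. k s *\<^sub>R (h t - h s))
      = (\<mu> - \<mu> * k 0) *\<^sub>R h t - integral {0..t} (\<lambda>s. k s *\<^sub>R h s)" .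
  have "1 / \<mu> * (\<mu> - \<mu> * k 0) = 1 - k 0" using \<open>0 < \<mu>\<close> by (simp add: field_simps)
  then have eq: "h t - (1 / \<mu>) *\<^sub>R integral {0..t} (\<lambda>s. k s *\<^sub>R h s)
      = k 0 *\<^sub>R h t + (1 / \<mu>) *\<^sub>R integral {0..t} (\<lambda>s. k s *\<^sub>R (h t - h s))"
    unfolding split unfolding scaleR_diff_right scaleR_scaleR by (simp add: scaleR_diff_left)
  have "norm (integral {0..t} (\<lambda>s. k s *\<^sub>R (h t - h s))) \<le> integral {0..t} (\<lambda>s. k s * (\<omega> + \<kappa> * (t - s)))"
  proof (rule integral_norm_bound_integral)
    show "norm (k s *\<^sub>R (h t - h s)) \<le> k s * (\<omega> + \<kappa> * (t - s))" if "s \<in> {0..t}" for s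
      using mod[OF that] by (simp add: k_def)
  qed (auto intro!: integrable_continuous_real ct has_integral_integrable[OF iw])
  also have "\<dots> = \<mu> * (\<omega> + \<kappa> * \<mu>) - \<mu> * (k 0 * (\<omega> + \<kappa> * t + \<kappa> * \<mu>))"
    using iw by (rule integral_unique)
  finally have "norm ((1 / \<mu>) *\<^sub>R integral {0..t} (\<lambda>s. k s *\<^sub>R (h t - h s)))
      \<le> (\<omega> + \<kappa> * \<mu>) - k 0 * (\<omega> + \<kappa> * t + \<kappa> * \<mu>)"
    using \<open>0 < \<mu>\<close> by (simp add: field_simps)
  moreover have "norm (k 0 *\<^sub>R h t) \<le> k 0 * (\<omega> + \<kappa> * t)"
    using mod[of 0] h0 \<open>0 \<le> t\<close> by (simp add: k_def)
  moreover have "0 \<le> k 0 * (\<kappa> * \<mu>)"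
    using \<open>0 < \<mu>\<close> \<open>0 \<le> \<kappa>\<close> by (simp add: k_def)
  ultimately have "norm (k 0 *\<^sub>R h t) + norm ((1 / \<mu>) *\<^sub>R integral {0..t} (\<lambda>s. k s *\<^sub>R (h t - h s)))
      \<le> \<omega> + \<kappa> * \<mu>" by (simp add: algebra_simps)
  then have "norm (h t - (1 / \<mu>) *\<^sub>R integral {0..t} (\<lambda>s. k s *\<^sub>R h s)) \<le> \<omega> + \<kappa> * \<mu>"
    unfolding eq by (rule norm_triangle_le)
  then show ?thesis unfolding k_def .
qed
section \<open>The small-mass limit along a path\<close>

text \<open>The constant produced by two successive applications of Gronwall's inequality, with rate \<open>2 * L\<close>
  for the size of \<open>x\<close> and with rate \<open>L\<close> for \<open>x - z\<close>. The arguments \<open>c\<close>, \<open>u\<close>, \<open>v\<close> stand for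
  the norms of \<open>b 0\<close>, of the initial position and of the initial velocity. It must not depend on
  the noise or on \<open>\<mu>\<close>, since it is later pulled out of an expectation.\<close>

definition small_mass_const :: "real \<Rightarrow> real \<Rightarrow> real \<Rightarrow> real \<Rightarrow> real \<Rightarrow> real" where
  "small_mass_const T L c u v =
     (2 * v + c + 1 + L * (u + 2 * v + 2 * T * c + 1) * exp (2 * L * T)) * exp (L * T)"

lemma small_mass_const_pos:
  assumes "0 < L" "0 \<le> T" "0 \<le> c" "0 \<le> u" "0 \<le> v"
  shows "0 < small_mass_const T L c u v"
  unfolding small_mass_const_def using assms by (intro mult_pos_pos add_nonneg_pos add_pos_nonneg mult_nonneg_nonneg) auto

text \<open>Integrating the velocity equation shows that \<open>x\<close> solves the first-order equation up to the error
  \<open>\<mu> y0 - v t\<close>, where \<open>v = \<mu> y\<close> is the momentum. By Gronwall it suffices that \<open>v\<close> is small. The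
  variation-of-constants formula splits \<open>v\<close> into the decaying initial momentum, a kernel average
  of \<open>b (x s)\<close>, and the noise response, which is bounded by \<open>\<Delta>\<close>. The kernel average is of order
  \<open>\<mu>\<close> once \<open>x\<close> is bounded uniformly in \<open>\<mu>\<close>, which takes a first application of Gronwall.\<close>

lemma small_mass_limit_pathwise:
  fixes x y z h :: "real \<Rightarrow> 'a::euclidean_space" and b :: "'a \<Rightarrow> 'a"
  assumes \<mu>: "0 < \<mu>" "\<mu> \<le> 1" and "0 < L"
    and lip: "\<And>u v. norm (b u - b v) \<le> L * norm (u - v)"
    and cx: "continuous_on {0..T} x" and cy: "continuous_on {0..T} y"
    and cz: "continuous_on {0..T} z" and ch: "continuous_on {0..T} h"
    and x: "\<And>t. t \<in> {0..T} \<Longrightarrow> x t = x0 + integral {0..t} y"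
    and y: "\<And>t. t \<in> {0..T} \<Longrightarrow>
      y t = y0 + (1 / \<mu>) *\<^sub>R integral {0..t} (\<lambda>s. - y s + b (x s)) + (1 / \<mu>) *\<^sub>R h t"
    and z: "\<And>t. t \<in> {0..T} \<Longrightarrow> z t = x0 + integral {0..t} (\<lambda>s. b (z s)) + h t"
    and \<sigma>: "\<And>t. t \<in> {0..T} \<Longrightarrow> norm (h t) \<le> \<sigma>"
    and \<Delta>: "\<And>t. t \<in> {0..T} \<Longrightarrow>
      norm (h t - (1 / \<mu>) *\<^sub>R integral {0..t} (\<lambda>s. exp (- (t - s) / \<mu>) *\<^sub>R h s)) \<le> \<Delta>"
    and t: "t \<in> {0..T}"
  shows "norm (x t - z t)
    \<le> small_mass_const T L (norm (b 0)) (norm x0) (norm y0) * (\<mu> * (1 + \<sigma>) + 2 * \<Delta>)"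
proof -
  define v where "v = (\<lambda>s. \<mu> *\<^sub>R y s)"
  have blin: "norm (b u) \<le> norm (b 0) + L * norm u" for u
    using lip[of u 0] norm_triangle_sub[of "b u" "b 0"] by simp
  have cb: "continuous_on A b" for A
    by (rule lipschitz_on_continuous_on[OF lipschitz_onI[of _ _ L]]) (use lip \<open>0 < L\<close> in \<open>auto simp: dist_norm\<close>)
  have cbx: "continuous_on {0..T} (\<lambda>s. b (x s))" "continuous_on {0..T} (\<lambda>s. b (z s))"
    by (auto intro!: continuous_on_compose2[OF cb[of UNIV]] cx cz)
  have cont: "continuous_on {0..s} f" if "continuous_on {0..T} f" "s \<in> {0..T}" for s and f :: "real \<Rightarrow> 'c::topological_space"
    using that by (auto intro: continuous_on_subset)
  have int: "f integrable_on {0..s}" if "continuous_on {0..T} f" "s \<in> {0..T}" for s and f :: "real \<Rightarrow> 'c::euclidean_space"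
    using integrable_continuous_real[OF cont[OF that]] .
  have "0 \<le> T" "norm (h 0) \<le> \<sigma>" "0 \<le> \<Delta>"
    using t \<sigma>[of 0] order_trans[OF norm_ge_zero \<Delta>[OF t]] by auto
  then have "0 \<le> \<sigma>" using order_trans[OF norm_ge_zero] by blast
  have cv: "continuous_on {0..T} v" unfolding v_def by (intro continuous_intros cy)
  have v: "v s = \<mu> *\<^sub>R y0 + integral {0..s} (\<lambda>r. b (x r) - (1 / \<mu>) *\<^sub>R v r) + h s" if s: "s \<in> {0..T}" for s
    using \<mu> y[OF s] by (simp add: v_def scaleR_add_right algebra_simps)
  \<comment> \<open>Momentum: initial layer, response to the drift, response to the noise.\<close>
  have repr: "v s = exp (- s / \<mu>) *\<^sub>R (\<mu> *\<^sub>R y0) + integral {0..s} (\<lambda>r. exp (- (s - r) / \<mu>) *\<^sub>R b (x r))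
      + (h s - (1 / \<mu>) *\<^sub>R integral {0..s} (\<lambda>r. exp (- (s - r) / \<mu>) *\<^sub>R h r))" if "s \<in> {0..T}" for s
    by (rule variation_of_constants[OF \<mu>(1) cv cbx(1) ch v that])
  have ek: "exp (- s / \<mu>) \<le> 1" if "0 \<le> s" for s using that \<mu> by simp
  \<comment> \<open>The first-order equation for \<open>x\<close>, perturbed by the change of momentum.\<close>
  have xv: "x s = x0 + integral {0..s} (\<lambda>r. b (x r)) + h s + \<mu> *\<^sub>R y0 - v s" if s: "s \<in> {0..T}" for s
  proof -
    have "integral {0..s} (\<lambda>r. b (x r) - (1 / \<mu>) *\<^sub>R v r) = integral {0..s} (\<lambda>r. b (x r)) - integral {0..s} y"
      using \<mu> by (subst integral_diff[symmetric]) (auto intro!: int cbx cy s simp: v_def)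
    then show ?thesis using v[OF s] x[OF s] by (simp add: algebra_simps)
  qed
  have vle: "norm (v s) \<le> \<mu> * norm y0 + norm (integral {0..s} (\<lambda>r. exp (- (s - r) / \<mu>) *\<^sub>R b (x r))) + \<Delta>"
    if s: "s \<in> {0..T}" for s
  proof -
    have "norm (exp (- s / \<mu>) *\<^sub>R (\<mu> *\<^sub>R y0)) \<le> \<mu> * norm y0"
      using ek[of s] s \<mu> by (simp add: mult_left_le_one_le)
    then show ?thesis
      unfolding repr[OF s] by (intro norm_triangle_le add_mono \<Delta>[OF s] order_refl)
  qed
  define K where "K = (norm x0 + 2 * norm y0 + 2 * T * norm (b 0) + \<sigma> + \<Delta>) * exp (2 * L * T)"
  \<comment> \<open>A bound on \<open>x\<close> uniform in \<open>\<mu>\<close>. The kernel is estimated by \<open>1\<close>: gaining the factor \<open>\<mu>\<close> here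
    would leave the supremum of \<open>x\<close> on the right-hand side, and \<open>\<mu> * L\<close> need not be small.\<close>
  have xK: "norm (x s) \<le> K" if s: "s \<in> {0..T}" for s
  proof -
    have "norm (x s) \<le> (norm x0 + 2 * norm y0 + 2 * T * norm (b 0) + \<sigma> + \<Delta>) * exp (2 * L * s)"
    proof (rule gronwall_integral[where T = T])
      fix r assume r: "r \<in> {0..T}"
      have ib: "(\<lambda>q. norm (b 0) + L * norm (x q)) integrable_on {0..r}"
        by (intro int r continuous_intros cx)
      have "norm (integral {0..r} (\<lambda>q. b (x q))) \<le> integral {0..r} (\<lambda>q. norm (b 0) + L * norm (x q))"
        by (intro integral_norm_bound_integral int cbx r ib blin)
      moreover have "norm (integral {0..r} (\<lambda>q. exp (- (r - q) / \<mu>) *\<^sub>R b (x q)))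
          \<le> integral {0..r} (\<lambda>q. norm (b 0) + L * norm (x q))"
      proof (intro integral_norm_bound_integral ib)
        show "(\<lambda>q. exp (- (r - q) / \<mu>) *\<^sub>R b (x q)) integrable_on {0..r}"
          using \<mu> by (intro int r continuous_intros cbx) auto
        show "norm (exp (- (r - q) / \<mu>) *\<^sub>R b (x q)) \<le> norm (b 0) + L * norm (x q)" if "q \<in> {0..r}" for q
        proof -
          have "norm (exp (- (r - q) / \<mu>) *\<^sub>R b (x q)) \<le> norm (b (x q))"
            using ek[of "r - q"] that by (simp add: mult_left_le_one_le)
          then show ?thesis using blin[of "x q"] by linarith
        qed
      qed
      moreover have "integral {0..r} (\<lambda>q. norm (b 0) + L * norm (x q))
          = r * norm (b 0) + L * integral {0..r} (\<lambda>q. norm (x q))"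
        using r by (subst integral_add) (auto intro!: int continuous_intros cx)
      moreover have "r * norm (b 0) \<le> T * norm (b 0)" using r by (intro mult_right_mono) auto
      moreover have "\<mu> * norm y0 \<le> norm y0" using \<mu> by (simp add: mult_left_le_one_le)
      moreover have "norm (x r) \<le> norm x0 + norm (integral {0..r} (\<lambda>q. b (x q))) + norm (h r) + \<mu> * norm y0 + norm (v r)"
        unfolding xv[OF r] using \<mu>
        by (intro norm_triangle_le norm_triangle_le_diff add_mono) auto
      ultimately show "norm (x r) \<le> norm x0 + 2 * norm y0 + 2 * T * norm (b 0) + \<sigma> + \<Delta>
          + 2 * L * integral {0..r} (\<lambda>q. norm (x q))"
        using vle[OF r] \<sigma>[OF r] by linarith
    qed (use \<open>0 < L\<close> s in \<open>auto intro!: continuous_intros cx\<close>)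
    also have "\<dots> \<le> K"
      unfolding K_def using s \<open>0 < L\<close> \<open>0 \<le> \<sigma>\<close> \<open>0 \<le> \<Delta>\<close> by (intro mult_left_mono) auto
    finally show ?thesis .
  qed
  \<comment> \<open>With \<open>x\<close> bounded, the mass \<open>\<mu>\<close> of the kernel makes the drift response small.\<close>
  have v2: "norm (v s) \<le> \<mu> * norm y0 + \<mu> * (norm (b 0) + L * K) + \<Delta>" if s: "s \<in> {0..T}" for s
  proof -
    have ik: "((\<lambda>r. exp (- (s - r) / \<mu>)) has_integral \<mu> - \<mu> * exp (- s / \<mu>)) {0..s}"
      using exponential_kernel_has_integral[OF \<mu>(1), of s 1 0] s by simp
    have "norm (integral {0..s} (\<lambda>r. exp (- (s - r) / \<mu>) *\<^sub>R b (x r)))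
        \<le> integral {0..s} (\<lambda>r. exp (- (s - r) / \<mu>) * (norm (b 0) + L * K))"
    proof (rule integral_norm_bound_integral)
      show "(\<lambda>r. exp (- (s - r) / \<mu>) *\<^sub>R b (x r)) integrable_on {0..s}"
        using \<mu> by (intro int s continuous_intros cbx) auto
      show "(\<lambda>r. exp (- (s - r) / \<mu>) * (norm (b 0) + L * K)) integrable_on {0..s}"
        using \<mu> by (intro int s continuous_intros) auto
      show "norm (exp (- (s - r) / \<mu>) *\<^sub>R b (x r)) \<le> exp (- (s - r) / \<mu>) * (norm (b 0) + L * K)"
        if "r \<in> {0..s}" for r
      proof -
        have "L * norm (x r) \<le> L * K" using xK[of r] that s \<open>0 < L\<close> by simp
        then have "norm (b (x r)) \<le> norm (b 0) + L * K" using blin[of "x r"] by linarith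
        then show ?thesis by simp
      qed
    qed
    also have "\<dots> = (\<mu> - \<mu> * exp (- s / \<mu>)) * (norm (b 0) + L * K)"
      by (rule integral_unique[OF has_integral_mult_left[OF ik]])
    also have "\<dots> \<le> \<mu> * (norm (b 0) + L * K)"
    proof (rule mult_right_mono)
      have "0 \<le> K" using order_trans[OF norm_ge_zero xK[OF s]] .
      then show "0 \<le> norm (b 0) + L * K" using \<open>0 < L\<close> by simp
    qed (use \<mu> in simp)
    finally show ?thesis using vle[OF s] by linarith
  qed
  define A where "A = 2 * \<mu> * norm y0 + \<Delta> + \<mu> * (norm (b 0) + L * K)"
  have "0 \<le> \<mu> * norm y0" using \<mu> by simp
  then have "0 \<le> A"
    using order_trans[OF norm_ge_zero v2[OF t]] unfolding A_def by linarith
  have "norm (x t - z t) \<le> A * exp (L * t)"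
  proof (rule gronwall_integral[where T = T])
    fix r assume r: "r \<in> {0..T}"
    have "x r - z r = integral {0..r} (\<lambda>q. b (x q) - b (z q)) + (\<mu> *\<^sub>R y0 - v r)"
      using xv[OF r] z[OF r] by (subst integral_diff) (auto intro!: int cbx r)
    also have "norm \<dots> \<le> integral {0..r} (\<lambda>q. L * norm (x q - z q)) + (\<mu> * norm y0 + norm (v r))"
    proof (intro norm_triangle_le add_mono)
      show "norm (integral {0..r} (\<lambda>q. b (x q) - b (z q))) \<le> integral {0..r} (\<lambda>q. L * norm (x q - z q))"
        by (intro integral_norm_bound_integral int r continuous_intros cbx cx cz lip)
      show "norm (\<mu> *\<^sub>R y0 - v r) \<le> \<mu> * norm y0 + norm (v r)"
        using norm_triangle_ineq4[of "\<mu> *\<^sub>R y0" "v r"] \<mu> by simp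
    qed
    finally show "norm (x r - z r) \<le> A + L * integral {0..r} (\<lambda>q. norm (x q - z q))"
      using v2[OF r] by (simp add: A_def)
  qed (use \<open>0 < L\<close> t in \<open>auto intro!: continuous_intros cx cz\<close>)
  also have "\<dots> \<le> A * exp (L * T)"
    using t \<open>0 < L\<close> \<open>0 \<le> A\<close> by (intro mult_left_mono) auto
  also have "\<dots> \<le> small_mass_const T L (norm (b 0)) (norm x0) (norm y0) * (\<mu> * (1 + \<sigma>) + 2 * \<Delta>)"
  proof -
    define e where "e = exp (2 * L * T)"
    define m where "m = \<mu> * (1 + \<sigma>) + 2 * \<Delta>"
    have "0 \<le> L" "0 \<le> e" "0 \<le> T" using \<open>0 < L\<close> \<open>0 \<le> T\<close> by (auto simp: e_def)
    have "\<mu> * \<Delta> \<le> \<Delta>" using \<mu> \<open>0 \<le> \<Delta>\<close> by (simp add: mult_left_le_one_le)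
    moreover have "0 \<le> \<mu> * \<sigma>" using \<mu> \<open>0 \<le> \<sigma>\<close> by simp
    ultimately have m: "\<mu> \<le> m" "\<Delta> \<le> m" "\<mu> * (\<sigma> + \<Delta>) \<le> m"
      using \<mu> \<open>0 \<le> \<Delta>\<close> unfolding m_def by (auto simp: algebra_simps)
    have "A = (2 * norm y0 + norm (b 0)) * \<mu> + \<Delta>
        + (L * (norm x0 + 2 * norm y0 + 2 * T * norm (b 0)) * e) * \<mu> + (L * e) * (\<mu> * (\<sigma> + \<Delta>))"
      by (simp add: A_def K_def e_def algebra_simps)
    also have "\<dots> \<le> (2 * norm y0 + norm (b 0)) * m + m
        + (L * (norm x0 + 2 * norm y0 + 2 * T * norm (b 0)) * e) * m + (L * e) * m"
      using \<open>0 \<le> L\<close> \<open>0 \<le> e\<close> \<open>0 \<le> T\<close>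
      by (intro add_mono mult_left_mono m mult_nonneg_nonneg add_nonneg_nonneg norm_ge_zero) auto
    also have "\<dots> = (2 * norm y0 + norm (b 0) + 1 + L * (norm x0 + 2 * norm y0 + 2 * T * norm (b 0) + 1) * e) * m"
      by (simp add: algebra_simps)
    finally have "A * exp (L * T) \<le> \<dots> * exp (L * T)" by (rule mult_right_mono) simp
    then show ?thesis by (simp add: small_mass_const_def e_def m_def mult_ac)
  qed
  finally show ?thesis .
qed

text \<open>In this form the forcing is the path \<open>g\<close> scaled by \<open>\<mu> powr \<alpha>\<close>. The size bound drops the scale,
  because it only multiplies \<open>\<mu>\<close> and \<open>\<mu> powr \<alpha> \<le> 1\<close>; the noise response keeps it, because it decides the rate.\<close>

lemma small_mass_limit_of_modulus:
  fixes x y z g :: "real \<Rightarrow> 'a::euclidean_space" and b :: "'a \<Rightarrow> 'a"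
  assumes \<mu>: "0 < \<mu>" "\<mu> \<le> 1" and "0 < L" and "0 \<le> T" and "0 \<le> \<alpha>"
    and lip: "\<And>u v. norm (b u - b v) \<le> L * norm (u - v)"
    and cx: "continuous_on {0..T} x" and cy: "continuous_on {0..T} y"
    and cz: "continuous_on {0..T} z" and cg: "continuous_on {0..T} g"
    and x: "\<And>t. t \<in> {0..T} \<Longrightarrow> x t = x0 + integral {0..t} y"
    and y: "\<And>t. t \<in> {0..T} \<Longrightarrow> y t = y0 + (1 / \<mu>) *\<^sub>R integral {0..t} (\<lambda>s. - y s + b (x s))
      + \<mu> powr (\<alpha> - 1) *\<^sub>R g t"
    and z: "\<And>t. t \<in> {0..T} \<Longrightarrow> z t = x0 + integral {0..t} (\<lambda>s. b (z s)) + \<mu> powr \<alpha> *\<^sub>R g t"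
    and g0: "g 0 = 0" and \<sigma>: "\<And>t. t \<in> {0..T} \<Longrightarrow> norm (g t) \<le> \<sigma>"
    and "0 \<le> \<kappa>"
    and mod: "\<And>s t. 0 \<le> s \<Longrightarrow> s \<le> t \<Longrightarrow> t \<le> T \<Longrightarrow> norm (g t - g s) \<le> \<omega> + \<kappa> * (t - s)"
    and t: "t \<in> {0..T}"
  shows "norm (x t - z t) \<le> small_mass_const T L (norm (b 0)) (norm x0) (norm y0)
      * (\<mu> * (1 + \<sigma>) + 2 * (\<mu> powr \<alpha> * (\<omega> + \<kappa> * \<mu>)))"
proof (rule small_mass_limit_pathwise[OF \<mu> \<open>0 < L\<close> lip cx cy cz _ x _ z _ _ t])
  let ?a = "\<mu> powr \<alpha>"
  have a: "0 \<le> ?a" "?a \<le> 1" using \<mu> \<open>0 \<le> \<alpha>\<close> by (auto intro: powr_le1)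
  show "continuous_on {0..T} (\<lambda>t. ?a *\<^sub>R g t)" by (intro continuous_intros cg)
  show "y t = y0 + (1 / \<mu>) *\<^sub>R integral {0..t} (\<lambda>s. - y s + b (x s)) + (1 / \<mu>) *\<^sub>R ?a *\<^sub>R g t"
    if "t \<in> {0..T}" for t
    using y[OF that] \<mu> by (simp add: powr_diff)
  show "norm (?a *\<^sub>R g t) \<le> \<sigma>" if "t \<in> {0..T}" for t
  proof -
    have "?a * norm (g t) \<le> norm (g t)" using a by (intro mult_left_le_one_le) auto
    then show ?thesis using \<sigma>[OF that] by simp
  qed
  show "norm (?a *\<^sub>R g t - (1 / \<mu>) *\<^sub>R integral {0..t} (\<lambda>s. exp (- (t - s) / \<mu>) *\<^sub>R ?a *\<^sub>R g s))
      \<le> ?a * (\<omega> + \<kappa> * \<mu>)" if t: "t \<in> {0..T}" for t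
  proof -
    have "?a *\<^sub>R g t - (1 / \<mu>) *\<^sub>R integral {0..t} (\<lambda>s. exp (- (t - s) / \<mu>) *\<^sub>R ?a *\<^sub>R g s)
        = ?a *\<^sub>R (g t - (1 / \<mu>) *\<^sub>R integral {0..t} (\<lambda>s. exp (- (t - s) / \<mu>) *\<^sub>R g s))"
      by (simp only: scaleR_left_commute[of _ ?a] integral_cmul scaleR_diff_right)
    also have "norm \<dots> = ?a * norm (g t - (1 / \<mu>) *\<^sub>R integral {0..t} (\<lambda>s. exp (- (t - s) / \<mu>) *\<^sub>R g s))"
      using a by simp
    also have "\<dots> \<le> ?a * (\<omega> + \<kappa> * \<mu>)"
      using a t mod
      by (intro mult_left_mono relaxation_error_le[OF \<mu>(1) \<open>0 \<le> \<kappa>\<close>] g0 continuous_on_subset[OF cg]) auto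
    finally show ?thesis .
  qed
qed

section \<open>Dyadic chaining along a path\<close>

text \<open>A square function rather than the maximum of the increments at level \<open>n\<close>: it dominates the
  maximum, and its second moment is a plain sum of second moments of increments.\<close>

definition dyadic_variation :: "real \<Rightarrow> (real \<Rightarrow> 'a::real_normed_vector) \<Rightarrow> nat \<Rightarrow> real" where
  "dyadic_variation T g n =
     sqrt (\<Sum>k<2^n. (norm (g (real (Suc k) * T / 2^n) - g (real k * T / 2^n)))\<^sup>2)"

definition chaining_bound :: "real \<Rightarrow> (real \<Rightarrow> 'a::real_normed_vector) \<Rightarrow> nat \<Rightarrow> real" where
  "chaining_bound T g n = (\<Sum>m. dyadic_variation T g (m + n))"

lemma dyadic_variation_nonneg: "0 \<le> dyadic_variation T g n"
  by (simp add: dyadic_variation_def sum_nonneg)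

lemma dyadic_increment_le_variation:
  assumes "k < 2^n"
  shows "norm (g (real (Suc k) * T / 2^n) - g (real k * T / 2^n)) \<le> dyadic_variation T g n"
  unfolding dyadic_variation_def
  by (rule real_le_rsqrt)
     (rule member_le_sum[where f = "\<lambda>k. (norm (g (real (Suc k) * T / 2^n) - g (real k * T / 2^n)))\<^sup>2"],
      use assms in auto)

lemma chaining_bound_nonneg:
  assumes "summable (dyadic_variation T g)"
  shows "0 \<le> chaining_bound T g n"
  unfolding chaining_bound_def
  by (intro suminf_nonneg dyadic_variation_nonneg) (simp add: assms)

lemma chaining_bound_split:
  assumes "summable (dyadic_variation T g)"
  shows "chaining_bound T g n = dyadic_variation T g n + chaining_bound T g (Suc n)"
  unfolding chaining_bound_def
  using suminf_split_head[of "\<lambda>m. dyadic_variation T g (m + n)"] assms by simp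

text \<open>Chaining: round \<open>t\<close> down to the dyadic grid of each level. From one level to the next the rounded
  point either stays or moves up by one mesh width of the finer level, so the value of \<open>g\<close> changes by at most the
  variation of the finer level; continuity identifies the limit of the chain as \<open>g t\<close>.\<close>

lemma dist_dyadic_floor_le:
  fixes g :: "real \<Rightarrow> 'a::real_normed_vector"
  assumes "0 < T" and cont: "continuous_on {0..T} g"
    and sm: "summable (dyadic_variation T g)" and t: "t \<in> {0..T}"
  shows "norm (g t - g (real (nat \<lfloor>2^n * t / T\<rfloor>) * T / 2^n)) \<le> chaining_bound T g (Suc n)"
proof -
  define k where "k = (\<lambda>n. nat \<lfloor>2^n * t / T\<rfloor>)"
  define p where "p = (\<lambda>n. real (k n) * T / 2^n)"
  have k: "real (k n) \<le> 2^n * t / T" "2^n * t / T < real (k n) + 1" for n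
    using t \<open>0 < T\<close> by (auto simp: k_def of_nat_nat)
  have p: "p n \<le> t" "t < p n + T / 2^n" for n
    using k[of n] \<open>0 < T\<close> by (auto simp: p_def field_simps)
  have p0: "0 \<le> p n" for n using \<open>0 < T\<close> by (simp add: p_def)
  have step: "norm (g (p (Suc n)) - g (p n)) \<le> dyadic_variation T g (Suc n)" for n
  proof -
    have "2 ^ Suc n * t / T = 2 * (2 ^ n * t / T)" by simp
    then have "real (k (Suc n)) < real (2 * k n + 2)" "real (2 * k n) < real (k (Suc n) + 1)"
      using k[of n] k[of "Suc n"] by linarith+
    then have "k (Suc n) = 2 * k n \<or> k (Suc n) = Suc (2 * k n)" by linarith
    then show ?thesis
    proof
      assume "k (Suc n) = 2 * k n"
      then show ?thesis by (simp add: p_def dyadic_variation_nonneg)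
    next
      assume *: "k (Suc n) = Suc (2 * k n)"
      have "2 ^ Suc n * t / T \<le> 2 ^ Suc n" using t \<open>0 < T\<close> by (simp add: field_simps)
      then have "real (k (Suc n)) \<le> real (2 ^ Suc n)" using k(1)[of "Suc n"] by simp
      then have "2 * k n < 2 ^ Suc n" unfolding of_nat_le_iff using * by linarith
      from dyadic_increment_le_variation[OF this, of g T] show ?thesis
        by (simp add: p_def *)
    qed
  qed
  have part: "norm (g (p (j + n)) - g (p n)) \<le> (\<Sum>i<j. dyadic_variation T g (i + Suc n))" for j
  proof (induction j)
    case (Suc j)
    have "norm (g (p (Suc j + n)) - g (p n))
        \<le> norm (g (p (Suc (j + n))) - g (p (j + n))) + norm (g (p (j + n)) - g (p n))"
      using norm_triangle_ineq[of "g (p (Suc (j + n))) - g (p (j + n))" "g (p (j + n)) - g (p n)"] by simp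
    then show ?case using Suc step[of "j + n"] by simp
  qed simp
  have le: "norm (g (p (j + n)) - g (p n)) \<le> chaining_bound T g (Suc n)" for j
    unfolding chaining_bound_def
    by (rule order_trans[OF part sum_le_suminf])
       (use summable_ignore_initial_segment[OF sm, of "Suc n"] in \<open>auto simp: dyadic_variation_nonneg\<close>)
  have "p \<longlonglongrightarrow> t"
  proof (rule tendsto_sandwich)
    show "(\<lambda>n. t - T / 2^n) \<longlonglongrightarrow> t"
      using tendsto_diff[OF tendsto_const LIMSEQ_divide_realpow_zero[of 2 T], of t] by simp
    show "\<forall>\<^sub>F n in sequentially. t - T / 2^n \<le> p n"
      using p(2) by (intro always_eventually allI) (simp add: algebra_simps less_imp_le)
  qed (use p(1) in auto)
  then have "(\<lambda>j. g (p (j + n))) \<longlonglongrightarrow> g t"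
    by (intro continuous_on_tendsto_compose[OF cont] LIMSEQ_ignore_initial_segment)
       (use p0 t order_trans[OF p(1)] in \<open>auto intro!: always_eventually\<close>)
  then have "(\<lambda>j. norm (g (p (j + n)) - g (p n))) \<longlonglongrightarrow> norm (g t - g (p n))"
    by (intro tendsto_intros)
  from LIMSEQ_le_const2[OF this] le show ?thesis by (auto simp: p_def k_def)
qed

text \<open>Times at most one mesh width apart round down to equal or adjacent grid points, so the two chains of
  finer levels are joined by at most one increment of level \<open>n\<close>.\<close>

lemma chaining_local_modulus:
  fixes g :: "real \<Rightarrow> 'a::real_normed_vector"
  assumes "0 < T" and cont: "continuous_on {0..T} g"
    and sm: "summable (dyadic_variation T g)"
    and s: "0 \<le> s" "s \<le> t" and t: "t \<le> T" and near: "t - s \<le> T / 2^n"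
  shows "norm (g t - g s) \<le> 2 * chaining_bound T g n"
proof -
  define k where "k = (\<lambda>r. nat \<lfloor>2^n * r / T\<rfloor>)"
  define p where "p = (\<lambda>r. real (k r) * T / 2^n)"
  have st: "s \<in> {0..T}" "t \<in> {0..T}" using s t by auto
  have k: "real (k r) \<le> 2^n * r / T" "2^n * r / T < real (k r) + 1" if "r \<in> {0..T}" for r
    using that \<open>0 < T\<close> by (auto simp: k_def of_nat_nat)
  have "norm (g (p t) - g (p s)) \<le> dyadic_variation T g n"
  proof -
    have "2^n * t / T \<le> 2^n * s / T + 1" "2^n * s / T \<le> 2^n * t / T"
      using near s \<open>0 < T\<close> by (auto simp: field_simps)
    then have "real (k t) < real (k s + 2)" "real (k s) < real (k t + 1)"
      using k[OF st(1)] k[OF st(2)] by auto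
    then have "k t = k s \<or> k t = Suc (k s)" by linarith
    then show ?thesis
    proof
      assume "k t = k s"
      then show ?thesis by (simp add: p_def dyadic_variation_nonneg)
    next
      assume *: "k t = Suc (k s)"
      have "2 ^ n * t / T \<le> 2 ^ n" using t \<open>0 < T\<close> by (simp add: field_simps)
      then have "real (k t) \<le> 2 ^ n" using k(1)[OF st(2)] by linarith
      then have "k t \<le> 2 ^ n" by simp
      then have "k s < 2 ^ n" using * by simp
      from dyadic_increment_le_variation[OF this, of g T] show ?thesis
        by (simp add: p_def *)
    qed
  qed
  moreover have "norm (g t - g (p t)) \<le> chaining_bound T g (Suc n)"
    "norm (g s - g (p s)) \<le> chaining_bound T g (Suc n)"
    using dist_dyadic_floor_le[OF \<open>0 < T\<close> cont sm] st by (auto simp: p_def k_def)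
  moreover have "norm (g t - g s) \<le> norm (g t - g (p t)) + norm (g (p t) - g (p s)) + norm (g s - g (p s))"
    by (smt (verit) norm_minus_commute norm_triangle_ineq2 norm_diff_triangle_le)
  moreover note chaining_bound_split[OF sm, of n] dyadic_variation_nonneg[of T g n]
  ultimately show ?thesis by linarith
qed

text \<open>Times further apart than one mesh width are charged the full oscillation of \<open>g\<close>, multiplied by the
  number of mesh widths between them. This yields the affine shape to which exponential averaging
  applies, with an intercept that vanishes as \<open>n\<close> grows.\<close>

lemma chaining_modulus:
  fixes g :: "real \<Rightarrow> 'a::real_normed_vector"
  assumes "0 < T" and cont: "continuous_on {0..T} g"
    and sm: "summable (dyadic_variation T g)"
    and s: "0 \<le> s" "s \<le> t" and t: "t \<le> T"
  shows "norm (g t - g s) \<le> 2 * chaining_bound T g n + 2 * 2^n / T * chaining_bound T g 0 * (t - s)"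
proof (cases "t - s \<le> T / 2^n")
  case True
  then show ?thesis
    using chaining_local_modulus[OF assms True] chaining_bound_nonneg[OF sm, of 0] \<open>0 < T\<close> s
    by (smt (verit) divide_nonneg_pos mult_nonneg_nonneg zero_le_power)
next
  case False
  then have "1 \<le> 2^n / T * (t - s)" using \<open>0 < T\<close> by (simp add: field_simps)
  then have "2 * chaining_bound T g 0 \<le> 2 * chaining_bound T g 0 * (2^n / T * (t - s))"
    using mult_left_mono[of 1 "2^n / T * (t - s)" "2 * chaining_bound T g 0"]
      chaining_bound_nonneg[OF sm, of 0] by simp
  moreover have "norm (g t - g s) \<le> 2 * chaining_bound T g 0"
    using chaining_local_modulus[OF assms, of 0] s t by simp
  ultimately show ?thesis
    using chaining_bound_nonneg[OF sm, of n] by (simp add: mult_ac)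
qed

section \<open>Moments of the chaining bound\<close>

text \<open>A case of Jensen's inequality, obtained from \<open>V \<le> c / 2 + V\<^sup>2 / (2 * c)\<close>, which is sharp at
  \<open>V = c\<close>.\<close>

lemma (in prob_space) nn_integral_le_of_second_moment:
  assumes [measurable]: "V \<in> borel_measurable M" and "0 < c"
    and sq: "(\<integral>\<^sup>+ w. ennreal ((V w)\<^sup>2) \<partial>M) \<le> ennreal (c\<^sup>2)"
  shows "(\<integral>\<^sup>+ w. ennreal (V w) \<partial>M) \<le> ennreal c"
proof -
  have "(\<integral>\<^sup>+ w. ennreal (V w) \<partial>M) \<le> (\<integral>\<^sup>+ w. ennreal (c / 2) + ennreal (1 / (2 * c)) * ennreal ((V w)\<^sup>2) \<partial>M)"
  proof (rule nn_integral_mono)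
    fix w
    have "0 \<le> (V w - c)\<^sup>2 / (2 * c)" using \<open>0 < c\<close> by simp
    also have "(V w - c)\<^sup>2 / (2 * c) = c / 2 + 1 / (2 * c) * (V w)\<^sup>2 - V w"
      using \<open>0 < c\<close> by (simp add: power2_eq_square field_simps)
    finally show "ennreal (V w) \<le> ennreal (c / 2) + ennreal (1 / (2 * c)) * ennreal ((V w)\<^sup>2)"
      using \<open>0 < c\<close> by (simp add: ennreal_mult[symmetric] ennreal_plus[symmetric] ennreal_leI del: ennreal_plus)
  qed
  also have "\<dots> = ennreal (c / 2) + ennreal (1 / (2 * c)) * (\<integral>\<^sup>+ w. ennreal ((V w)\<^sup>2) \<partial>M)"
    by (simp add: nn_integral_add nn_integral_cmult emeasure_space_1)
  also have "\<dots> \<le> ennreal (c / 2) + ennreal (1 / (2 * c)) * ennreal (c\<^sup>2)"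
    by (intro add_left_mono mult_left_mono sq) auto
  also have "\<dots> = ennreal (c / 2 + 1 / (2 * c) * c\<^sup>2)"
    using \<open>0 < c\<close> by (simp add: ennreal_mult[symmetric] ennreal_plus[symmetric] del: ennreal_plus)
  also have "c / 2 + 1 / (2 * c) * c\<^sup>2 = c"
    using \<open>0 < c\<close> by (simp add: power2_eq_square field_simps)
  finally show ?thesis .
qed

text \<open>Level \<open>n\<close> has \<open>2 ^ n\<close> increments, each of mean square at most \<open>C (T / 2 ^ n) powr p\<close>, so the second
  moment of the variation is of order \<open>2 powr (n (1 - p))\<close>.\<close>

lemma (in prob_space) expected_dyadic_variation:
  fixes W :: "real \<Rightarrow> 'a \<Rightarrow> 'b::euclidean_space"
  assumes "0 < T" and "0 < C"
    and meas: "\<And>t. t \<in> {0..T} \<Longrightarrow> W t \<in> borel_measurable M"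
    and inc: "\<And>s t. s \<in> {0..T} \<Longrightarrow> t \<in> {0..T} \<Longrightarrow>
      (\<integral>\<^sup>+ w. ennreal ((norm (W t w - W s w))\<^sup>2) \<partial>M) \<le> ennreal (C * \<bar>t - s\<bar> powr p)"
  shows "(\<lambda>w. dyadic_variation T (\<lambda>t. W t w) n) \<in> borel_measurable M"
    and "(\<integral>\<^sup>+ w. ennreal (dyadic_variation T (\<lambda>t. W t w) n) \<partial>M)
      \<le> ennreal (sqrt (C * T powr p) * (2 powr ((1 - p) / 2)) ^ n)"
proof -
  define c where "c = sqrt (C * T powr p) * (2 powr ((1 - p) / 2)) ^ n"
  have "0 < c" using \<open>0 < T\<close> \<open>0 < C\<close> by (simp add: c_def)
  have grid: "real k * T / 2^n \<in> {0..T}" if "k \<le> 2^n" for k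
  proof -
    have "real k \<le> 2^n" using that by simp
    then show ?thesis using \<open>0 < T\<close> by (simp add: field_simps)
  qed
  have m: "W (real k * T / 2^n) \<in> borel_measurable M" if "k \<le> 2^n" for k
    using meas[OF grid[OF that]] .
  have m': "(\<lambda>w. (norm (W (real (Suc k) * T / 2^n) w - W (real k * T / 2^n) w))\<^sup>2) \<in> borel_measurable M"
    if "k < 2^n" for k
  proof -
    have [measurable]: "W (real (Suc k) * T / 2^n) \<in> borel_measurable M" "W (real k * T / 2^n) \<in> borel_measurable M"
      using that by (auto intro!: m simp del: of_nat_Suc)
    show ?thesis by measurable
  qed
  show mV: "(\<lambda>w. dyadic_variation T (\<lambda>t. W t w) n) \<in> borel_measurable M"
    unfolding dyadic_variation_def
    by (rule measurable_compose[OF borel_measurable_sum borel_measurable_sqrt]) (rule m', simp)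
  have "(\<integral>\<^sup>+ w. ennreal ((dyadic_variation T (\<lambda>t. W t w) n)\<^sup>2) \<partial>M)
      = (\<integral>\<^sup>+ w. (\<Sum>k<2^n. ennreal ((norm (W (real (Suc k) * T / 2^n) w - W (real k * T / 2^n) w))\<^sup>2)) \<partial>M)"
    by (simp add: dyadic_variation_def sum_nonneg sum_ennreal)
  also have "\<dots> = (\<Sum>k<2^n. \<integral>\<^sup>+ w. ennreal ((norm (W (real (Suc k) * T / 2^n) w - W (real k * T / 2^n) w))\<^sup>2) \<partial>M)"
    by (intro nn_integral_sum measurable_compose[OF m' measurable_ennreal]) auto
  also have "\<dots> \<le> (\<Sum>k<(2::nat)^n. ennreal (C * (T / 2^n) powr p))"
  proof (rule sum_mono)
    fix k :: nat assume "k \<in> {..<2^n}"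
    then have k: "k \<le> 2^n" "Suc k \<le> 2^n" by auto
    have "\<bar>real (Suc k) * T / 2^n - real k * T / 2^n\<bar> = T / 2^n"
      using \<open>0 < T\<close> by (simp add: field_simps)
    then show "(\<integral>\<^sup>+ w. ennreal ((norm (W (real (Suc k) * T / 2^n) w - W (real k * T / 2^n) w))\<^sup>2) \<partial>M)
        \<le> ennreal (C * (T / 2^n) powr p)"
      using inc[OF grid[OF k(1)] grid[OF k(2)]] by simp
  qed
  also have "\<dots> = ennreal (2^n * (C * (T / 2^n) powr p))"
    using \<open>0 < C\<close> by (subst sum_ennreal) simp_all
  also have "2^n * (C * (T / 2^n) powr p) = c\<^sup>2"
  proof -
    have "((2 powr ((1 - p) / 2)) ^ n)\<^sup>2 = (2::real) powr (real 2 * (real n * ((1 - p) / 2)))"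
      by (simp only: powr_power)
    also have "real 2 * (real n * ((1 - p) / 2)) = real n - real n * p" by (simp add: field_simps)
    also have "2 powr (real n - real n * p) = 2 powr real n / (2 powr real n) powr p"
      by (simp only: powr_diff powr_powr)
    also have "2 powr real n = (2::real) ^ n" by (simp add: powr_realpow)
    finally have q2: "((2 powr ((1 - p) / 2)) ^ n)\<^sup>2 = (2::real) ^ n / (2 ^ n) powr p" .
    have "(T / 2^n) powr p = T powr p / (2 ^ n) powr p" using \<open>0 < T\<close> by (intro powr_divide)
    then show ?thesis
      using \<open>0 < C\<close> by (simp add: c_def power_mult_distrib q2)
  qed
  finally show "(\<integral>\<^sup>+ w. ennreal (dyadic_variation T (\<lambda>t. W t w) n) \<partial>M) \<le> ennreal c"
    by (rule nn_integral_le_of_second_moment[OF mV \<open>0 < c\<close>])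
qed

text \<open>Kolmogorov's continuity criterion in quantitative form. For \<open>p > 1\<close> the expected variations decay
  geometrically, so the chaining bound of level \<open>n\<close> has an expectation that decays at the same rate;
  finiteness of the expected total gives summability along almost every path.\<close>

lemma (in prob_space) expected_chaining_bound:
  fixes W :: "real \<Rightarrow> 'a \<Rightarrow> 'b::euclidean_space"
  assumes "0 < T" and "0 < C" and "1 < p"
    and meas: "\<And>t. t \<in> {0..T} \<Longrightarrow> W t \<in> borel_measurable M"
    and inc: "\<And>s t. s \<in> {0..T} \<Longrightarrow> t \<in> {0..T} \<Longrightarrow>
      (\<integral>\<^sup>+ w. ennreal ((norm (W t w - W s w))\<^sup>2) \<partial>M) \<le> ennreal (C * \<bar>t - s\<bar> powr p)"
  defines "q \<equiv> 2 powr ((1 - p) / 2)"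
  shows "AE w in M. summable (dyadic_variation T (\<lambda>t. W t w))"
    and "(\<lambda>w. chaining_bound T (\<lambda>t. W t w) n) \<in> borel_measurable M"
    and "(\<integral>\<^sup>+ w. ennreal (chaining_bound T (\<lambda>t. W t w) n) \<partial>M)
      \<le> ennreal (sqrt (C * T powr p) / (1 - q) * q ^ n)"
proof -
  define V where "V = (\<lambda>n w. dyadic_variation T (\<lambda>t. W t w) n)"
  have q: "0 < q" "q < 1"
    unfolding q_def using \<open>1 < p\<close> powr_less_mono[of "(1 - p) / 2" 0 "2::real"] by auto
  have mV[measurable]: "V n \<in> borel_measurable M" for n
    unfolding V_def by (rule expected_dyadic_variation(1)[OF assms(1,2) meas inc])
  have total: "(\<integral>\<^sup>+ w. (\<Sum>m. ennreal (V (m + n) w)) \<partial>M) \<le> ennreal (sqrt (C * T powr p) / (1 - q) * q ^ n)" for n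
  proof -
    have "(\<integral>\<^sup>+ w. (\<Sum>m. ennreal (V (m + n) w)) \<partial>M) = (\<Sum>m. \<integral>\<^sup>+ w. ennreal (V (m + n) w) \<partial>M)"
      by (rule nn_integral_suminf) simp
    also have "\<dots> \<le> (\<Sum>m. ennreal (sqrt (C * T powr p) * q ^ (m + n)))"
      unfolding V_def q_def
      by (intro suminf_le expected_dyadic_variation(2)[OF assms(1,2) meas inc]) auto
    also have "\<dots> = ennreal (sqrt (C * T powr p) / (1 - q) * q ^ n)"
    proof (rule suminf_ennreal_eq)
      have "(\<lambda>m. sqrt (C * T powr p) * q ^ n * q ^ m) sums (sqrt (C * T powr p) * q ^ n * (1 / (1 - q)))"
        using q by (intro sums_mult geometric_sums) simp
      then show "(\<lambda>m. sqrt (C * T powr p) * q ^ (m + n)) sums (sqrt (C * T powr p) / (1 - q) * q ^ n)"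
        by (simp add: power_add mult_ac)
    qed (use q \<open>0 < C\<close> in simp)
    finally show ?thesis .
  qed
  have "AE w in M. (\<Sum>m. ennreal (V m w)) \<noteq> \<infinity>"
  proof (rule nn_integral_noteq_infinite)
    show "(\<integral>\<^sup>+ w. (\<Sum>m. ennreal (V m w)) \<partial>M) \<noteq> \<infinity>"
      using total[of 0] by (auto simp: top_unique)
  qed measurable
  then show sm: "AE w in M. summable (dyadic_variation T (\<lambda>t. W t w))"
    by eventually_elim (rule summable_suminf_not_top, auto simp: V_def dyadic_variation_nonneg)
  show "(\<lambda>w. chaining_bound T (\<lambda>t. W t w) n) \<in> borel_measurable M"
    unfolding chaining_bound_def using mV by (intro borel_measurable_suminf) (simp add: V_def)
  have "(\<integral>\<^sup>+ w. ennreal (chaining_bound T (\<lambda>t. W t w) n) \<partial>M) = (\<integral>\<^sup>+ w. (\<Sum>m. ennreal (V (m + n) w)) \<partial>M)"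
    using sm by (intro nn_integral_cong_AE, eventually_elim)
      (simp add: chaining_bound_def V_def suminf_ennreal2 dyadic_variation_nonneg)
  with total show "(\<integral>\<^sup>+ w. ennreal (chaining_bound T (\<lambda>t. W t w) n) \<partial>M)
      \<le> ennreal (sqrt (C * T powr p) / (1 - q) * q ^ n)" by simp
qed

text \<open>The covariance alone determines the mean square of an increment, but the Bochner integral of a
  non-integrable function is \<open>0\<close>, so square integrability has to be established first.\<close>

lemma real_fbm_increment:
  assumes fbm: "real_fbm M T H W" and "0 < H"
    and meas: "\<And>t. t \<in> {0..T} \<Longrightarrow> W t \<in> borel_measurable M"
    and st: "s \<in> {0..T}" "t \<in> {0..T}"
  shows "(\<integral>\<^sup>+ w. ennreal ((W t w - W s w)\<^sup>2) \<partial>M) = ennreal (\<bar>t - s\<bar> powr (2 * H))"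
proof -
  have cov: "(\<integral>w. W s w * W t w \<partial>M) = (s powr (2 * H) + t powr (2 * H) - \<bar>t - s\<bar> powr (2 * H)) / 2"
    if "s \<in> {0..T}" "t \<in> {0..T}" for s t
    using fbm that by (auto simp: real_fbm_def)
  have sq: "integrable M (\<lambda>w. W t w * W t w)" if t: "t \<in> {0..T}" for t
  proof (cases "t = 0")
    case True
    have "AE w in M. W t w * W t w = 0" using fbm True by (auto simp: real_fbm_def)
    moreover have "(\<lambda>w. W t w * W t w) \<in> borel_measurable M" using meas[OF t] by measurable
    ultimately show ?thesis
      using integrable_cong_AE[of "\<lambda>w. W t w * W t w" M "\<lambda>_. 0"] by simp
  next
    case False
    \<comment> \<open>The variance is a nonzero number, which excludes the default value of the integral.\<close>
    then have "(\<integral>w. W t w * W t w \<partial>M) \<noteq> 0" using cov[OF t t] t by simp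
    then show ?thesis using not_integrable_integral_eq by blast
  qed
  note [measurable] = meas[OF st(1)] meas[OF st(2)]
  have prod: "integrable M (\<lambda>w. W s w * W t w)"
  proof (rule Bochner_Integration.integrable_bound[OF Bochner_Integration.integrable_add[OF sq[OF st(1)] sq[OF st(2)]]])
    have "\<bar>a * b\<bar> \<le> \<bar>a * a + b * b\<bar>" for a b :: real
    proof -
      have "0 \<le> \<bar>a\<bar> * \<bar>b\<bar>" "\<bar>a * b\<bar> = \<bar>a\<bar> * \<bar>b\<bar>" by (auto simp: abs_mult)
      moreover have "2 * (\<bar>a\<bar> * \<bar>b\<bar>) \<le> a * a + b * b"
        using sum_squares_bound[of "\<bar>a\<bar>" "\<bar>b\<bar>"] by (simp add: power2_eq_square)
      ultimately show ?thesis by linarith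
    qed
    then show "AE w in M. norm (W s w * W t w) \<le> norm (W s w * W s w + W t w * W t w)" by simp
  qed measurable
  have eq: "(W t w - W s w)\<^sup>2 = W t w * W t w + W s w * W s w - 2 * (W s w * W t w)" for w
    by (simp add: power2_eq_square algebra_simps)
  have int: "integrable M (\<lambda>w. (W t w - W s w)\<^sup>2)"
    unfolding eq using sq st prod by auto
  have "(\<integral>w. (W t w - W s w)\<^sup>2 \<partial>M) = \<bar>t - s\<bar> powr (2 * H)"
    unfolding eq using sq st prod by (simp add: cov) (simp add: field_simps)
  then show ?thesis using nn_integral_eq_integral[OF int] by simp
qed

lemma fbm_increment:
  fixes B :: "real \<Rightarrow> 'w \<Rightarrow> real ^ 'd"
  assumes fbm: "\<And>i. real_fbm M T H (\<lambda>t w. B t w $ i)" and "0 < H"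
    and meas: "\<And>t. t \<in> {0..T} \<Longrightarrow> B t \<in> borel_measurable M"
    and st: "s \<in> {0..T}" "t \<in> {0..T}"
  shows "(\<integral>\<^sup>+ w. ennreal ((norm (B t w - B s w))\<^sup>2) \<partial>M) = ennreal (real CARD('d) * \<bar>t - s\<bar> powr (2 * H))"
proof -
  have m: "(\<lambda>w. B t w $ i) \<in> borel_measurable M" if "t \<in> {0..T}" for t i
    unfolding cart_eq_inner_axis by (rule borel_measurable_inner[OF meas[OF that] measurable_const]) simp
  have "(\<integral>\<^sup>+ w. ennreal ((norm (B t w - B s w))\<^sup>2) \<partial>M)
      = (\<integral>\<^sup>+ w. (\<Sum>i\<in>UNIV. ennreal ((B t w $ i - B s w $ i)\<^sup>2)) \<partial>M)"
    by (simp add: norm_vec_def L2_set_def sum_nonneg sum_ennreal)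
  also have "\<dots> = (\<Sum>i\<in>UNIV. \<integral>\<^sup>+ w. ennreal ((B t w $ i - B s w $ i)\<^sup>2) \<partial>M)"
  proof (rule nn_integral_sum)
    fix i :: 'd
    note [measurable] = m[OF st(1), of i] m[OF st(2), of i]
    show "(\<lambda>w. ennreal ((B t w $ i - B s w $ i)\<^sup>2)) \<in> borel_measurable M" by measurable
  qed
  also have "\<dots> = (\<Sum>i\<in>(UNIV :: 'd set). ennreal (\<bar>t - s\<bar> powr (2 * H)))"
    by (intro sum.cong refl real_fbm_increment[OF fbm \<open>0 < H\<close> m st])
  also have "\<dots> = ennreal (real CARD('d) * \<bar>t - s\<bar> powr (2 * H))"
    by (subst sum_ennreal) simp_all
  finally show ?thesis .
qed

section \<open>The small-mass limit driven by fractional Brownian motion\<close>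

lemma (in prob_space) nn_integral_affine_le:
  fixes u v :: "'a \<Rightarrow> real"
  assumes [measurable]: "u \<in> borel_measurable M" "v \<in> borel_measurable M"
    and u: "(\<integral>\<^sup>+ w. ennreal (u w) \<partial>M) \<le> ennreal r" and v: "(\<integral>\<^sup>+ w. ennreal (v w) \<partial>M) \<le> ennreal r'"
    and nonneg: "0 \<le> a" "0 \<le> \<beta>" "0 \<le> \<gamma>" "0 \<le> r" "0 \<le> r'"
  shows "(\<integral>\<^sup>+ w. ennreal (a + \<beta> * u w + \<gamma> * v w) \<partial>M) \<le> ennreal (a + \<beta> * r + \<gamma> * r')"
proof -
  have "(\<integral>\<^sup>+ w. ennreal (a + \<beta> * u w + \<gamma> * v w) \<partial>M)
      \<le> (\<integral>\<^sup>+ w. ennreal a + ennreal \<beta> * ennreal (u w) + ennreal \<gamma> * ennreal (v w) \<partial>M)"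
  proof (rule nn_integral_mono)
    fix w
    \<comment> \<open>The coercion to \<open>ennreal\<close> truncates at \<open>0\<close>, so it is additive only on the positive parts.\<close>
    have "ennreal (a + \<beta> * u w + \<gamma> * v w)
        \<le> ennreal (a + \<beta> * max 0 (u w) + \<gamma> * max 0 (v w))"
      using nonneg by (intro ennreal_leI add_mono mult_left_mono) auto
    also have "\<dots> = ennreal a + ennreal \<beta> * ennreal (u w) + ennreal \<gamma> * ennreal (v w)"
      using nonneg by (simp add: ennreal_plus ennreal_mult ennreal_max_0)
    finally show "ennreal (a + \<beta> * u w + \<gamma> * v w) \<le> \<dots>" .
  qed
  also have "\<dots> = ennreal a + ennreal \<beta> * (\<integral>\<^sup>+ w. ennreal (u w) \<partial>M) + ennreal \<gamma> * (\<integral>\<^sup>+ w. ennreal (v w) \<partial>M)"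
    by (simp add: nn_integral_add nn_integral_cmult emeasure_space_1)
  also have "\<dots> \<le> ennreal a + ennreal \<beta> * ennreal r + ennreal \<gamma> * ennreal r'"
    by (intro add_mono mult_left_mono u v order_refl) auto
  also have "\<dots> = ennreal (a + \<beta> * r + \<gamma> * r')"
    using nonneg by (simp add: ennreal_plus ennreal_mult)
  finally show ?thesis .
qed

lemma fbm_AE_regular:
  fixes B :: "real \<Rightarrow> 'w \<Rightarrow> real ^ 'd"
  assumes "\<And>i. real_fbm M T H (\<lambda>t w. B t w $ i)"
  shows "AE w in M. B 0 w = 0 \<and> continuous_on {0..T} (\<lambda>t. B t w)"
proof -
  have "AE w in M. \<forall>i\<in>UNIV. B 0 w $ i = 0 \<and> continuous_on {0..T} (\<lambda>t. B t w $ i)"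
    using assms by (subst AE_finite_all) (auto simp: real_fbm_def continuous_process_def)
  then show ?thesis
  proof eventually_elim
    case (elim w)
    have "continuous_on {0..T} (\<lambda>t. \<chi> i. B t w $ i)"
      using elim by (intro continuous_on_vec_lambda) auto
    then show ?case using elim by (simp add: vec_eq_iff)
  qed
qed

text \<open>Two consequences of the same pathwise comparison, which differ in the modulus of continuity that is
  supplied. The constant modulus \<open>2 * R 0\<close> gives the rate \<open>\<mu> powr \<alpha>\<close>. The affine modulus keeps the
  error small for \<open>\<alpha> = 0\<close>: first \<open>n\<close> is taken large, then \<open>\<mu>\<close> small.\<close>

lemma second_first_order_error:
  fixes B :: "real \<Rightarrow> 'w \<Rightarrow> real ^ 'd" and b :: "real ^ 'd \<Rightarrow> real ^ 'd"
  assumes \<mu>: "0 < \<mu>" "\<mu> \<le> 1" and "0 < L" and "0 < T" and "0 \<le> \<alpha>"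
    and lip: "\<And>u v. norm (b u - b v) \<le> L * norm (u - v)"
    and reg: "AE w in M. B 0 w = 0 \<and> continuous_on {0..T} (\<lambda>t. B t w)"
    and sm: "AE w in M. summable (dyadic_variation T (\<lambda>t. B t w))"
    and X: "second_order_solution M F T B b \<alpha> x0 y0 \<mu> X Y"
    and Z: "first_order_solution M F T B b \<alpha> x0 \<mu> Z"
  defines "K \<equiv> small_mass_const T L (norm (b 0)) (norm x0) (norm y0)"
    and "R \<equiv> \<lambda>n w. chaining_bound T (\<lambda>t. B t w) n"
  shows "AE w in M. \<forall>t\<in>{0..T}.
      norm (X t w - Z t w) \<le> K * (\<mu> * (1 + 2 * R 0 w) + 2 * (\<mu> powr \<alpha> * (2 * R 0 w)))"
    and "AE w in M. \<forall>t\<in>{0..T}.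
      norm (X t w - Z t w)
        \<le> K * (\<mu> * (1 + 2 * R 0 w) + 2 * (\<mu> powr \<alpha> * (2 * R n w + 2 * 2^n / T * R 0 w * \<mu>)))"
proof -
  have path: "AE w in M. \<forall>\<omega> \<kappa>. 0 \<le> \<kappa> \<longrightarrow>
      (\<forall>s t. 0 \<le> s \<longrightarrow> s \<le> t \<longrightarrow> t \<le> T \<longrightarrow> norm (B t w - B s w) \<le> \<omega> + \<kappa> * (t - s)) \<longrightarrow>
      (\<forall>t\<in>{0..T}. norm (X t w - Z t w) \<le> K * (\<mu> * (1 + 2 * R 0 w) + 2 * (\<mu> powr \<alpha> * (\<omega> + \<kappa> * \<mu>))))"
    using X[unfolded second_order_solution_def continuous_process_def, THEN conjunct2, THEN conjunct2]
      Z[unfolded first_order_solution_def continuous_process_def, THEN conjunct2] reg sm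
    unfolding eventually_conj_iff[symmetric]
  proof eventually_elim
    case (elim w)
    have c: "continuous_on {0..T} (\<lambda>t. B t w)" and s: "summable (dyadic_variation T (\<lambda>t. B t w))"
      and B0: "B 0 w = 0" using elim by auto
    have size: "norm (B t w) \<le> 2 * R 0 w" if "t \<in> {0..T}" for t
      using chaining_local_modulus[OF \<open>0 < T\<close> c s, of 0 t 0] that B0 by (simp add: R_def)
    show ?case
      unfolding K_def using elim size \<open>0 < T\<close>
      by (intro allI impI ballI small_mass_limit_of_modulus[OF \<mu> \<open>0 < L\<close> _ \<open>0 \<le> \<alpha>\<close> lip,
            where y = "\<lambda>t. Y t w" and g = "\<lambda>t. B t w"]) auto
  qed
  show "AE w in M. \<forall>t\<in>{0..T}.
      norm (X t w - Z t w) \<le> K * (\<mu> * (1 + 2 * R 0 w) + 2 * (\<mu> powr \<alpha> * (2 * R 0 w)))"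
    using path reg sm
  proof eventually_elim
    case (elim w)
    have "norm (B t w - B s w) \<le> 2 * R 0 w + 0 * (t - s)" if "0 \<le> s" "s \<le> t" "t \<le> T" for s t
      using chaining_local_modulus[OF \<open>0 < T\<close> _ _ that, of "\<lambda>t. B t w" 0] elim(2,3) that
      by (simp add: R_def)
    with elim(1)[rule_format, of 0 "2 * R 0 w"] show ?case by simp
  qed
  show "AE w in M. \<forall>t\<in>{0..T}.
      norm (X t w - Z t w)
        \<le> K * (\<mu> * (1 + 2 * R 0 w) + 2 * (\<mu> powr \<alpha> * (2 * R n w + 2 * 2^n / T * R 0 w * \<mu>)))"
    using path reg sm
  proof eventually_elim
    case (elim w)
    have "norm (B t w - B s w) \<le> 2 * R n w + (2 * 2^n / T * R 0 w) * (t - s)"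
      if "0 \<le> s" "s \<le> t" "t \<le> T" for s t
      using chaining_modulus[OF \<open>0 < T\<close> _ _ that, of "\<lambda>t. B t w" n] elim(2,3) by (simp add: R_def)
    moreover have "0 \<le> 2 * 2^n / T * R 0 w"
      using chaining_bound_nonneg[OF elim(3), of 0] \<open>0 < T\<close> by (simp add: R_def)
    ultimately show ?case using elim(1) by blast
  qed
qed

theorem theorem3p1:
  fixes M :: "'w measure" and F :: "real \<Rightarrow> 'w measure"
    and B :: "real \<Rightarrow> 'w \<Rightarrow> real ^ 'd"
    and b :: "real ^ 'd \<Rightarrow> real ^ 'd" and x0 y0 :: "real ^ 'd"
    and H T L \<alpha> :: real
    and X Y Xbar :: "real \<Rightarrow> real \<Rightarrow> 'w \<Rightarrow> real ^ 'd"
  assumes "1 / 2 < H" and "H < 1" and "0 < T"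
    and "usual_filtered_prob_space M F T"
    and "fbm M F T H B"
    and "0 < L" and "\<forall>x1 x2. norm (b x1 - b x2) \<le> L * norm (x1 - x2)"
    and "0 \<le> \<alpha>" and "\<alpha> < 1"
    and "\<forall>\<mu>\<in>{0<..1}. second_order_solution M F T B b \<alpha> x0 y0 \<mu> (X \<mu>) (Y \<mu>)"
    and "\<forall>\<mu>\<in>{0<..1}. first_order_solution M F T B b \<alpha> x0 \<mu> (Xbar \<mu>)"
  shows "(0 < \<alpha> \<longrightarrow>
            (\<exists>C>0. \<forall>\<mu>\<in>{0<..1}.
               (\<integral>\<^sup>+ w. (SUP t\<in>{0..T}. ennreal (norm (X \<mu> t w - Xbar \<mu> t w))) \<partial>M)
                 \<le> ennreal (C * \<mu> powr \<alpha>))) \<and>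
         (\<alpha> = 0 \<longrightarrow>
            ((\<lambda>\<mu>. SUP t\<in>{0..T}. \<integral>\<^sup>+ w. ennreal (norm (X \<mu> t w - Xbar \<mu> t w)) \<partial>M)
               \<longlongrightarrow> 0) (at_right 0))"
proof -
  interpret usual_filtered_prob_space M F T by fact
  define R where "R = (\<lambda>n w. chaining_bound T (\<lambda>t. B t w) n)"
  define K where "K = small_mass_const T L (norm (b 0)) (norm x0) (norm y0)"
  define q where "q = 2 powr ((1 - 2 * H) / 2)"
  define A where "A = sqrt (real CARD('d) * T powr (2 * H)) / (1 - q)"
  have "0 < K" unfolding K_def using \<open>0 < L\<close> \<open>0 < T\<close> by (intro small_mass_const_pos) auto
  have "0 < q" by (simp add: q_def)
  have "q < 1"
    unfolding q_def using \<open>1 / 2 < H\<close> powr_less_mono[of "(1 - 2 * H) / 2" 0 "2::real"] by auto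
  then have "0 \<le> A" by (simp add: A_def)
  have fbm: "real_fbm M T H (\<lambda>t w. B t w $ i)" for i
    using \<open>fbm M F T H B\<close> by (auto simp: fbm_def)
  have meas: "B t \<in> borel_measurable M" if "t \<in> {0..T}" for t
  proof (rule measurable_from_subalg[OF subalgebra_F[OF that]])
    show "B t \<in> borel_measurable (F t)"
      using \<open>fbm M F T H B\<close> that unfolding fbm_def adapted_process_def by blast
  qed
  have lip: "norm (b u - b v) \<le> L * norm (u - v)" for u v using assms(7) by blast
  have inc: "(\<integral>\<^sup>+ w. ennreal ((norm (B t w - B s w))\<^sup>2) \<partial>M) \<le> ennreal (real CARD('d) * \<bar>t - s\<bar> powr (2 * H))"
    if "s \<in> {0..T}" "t \<in> {0..T}" for s t
    using fbm_increment[OF fbm _ meas that] \<open>1 / 2 < H\<close> by simp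
  have "(0::real) < real CARD('d)" "1 < 2 * H" using \<open>1 / 2 < H\<close> by auto
  note chain = expected_chaining_bound[OF \<open>0 < T\<close> this meas inc]
  have sm: "AE w in M. summable (dyadic_variation T (\<lambda>t. B t w))" using chain(1) by simp
  have Rm: "R n \<in> borel_measurable M" for n using chain(2) by (simp add: R_def)
  have Rint: "(\<integral>\<^sup>+ w. ennreal (R n w) \<partial>M) \<le> ennreal (A * q ^ n)" for n
    using chain(3)[of n] by (simp add: R_def A_def q_def)
  have err0: "AE w in M. \<forall>t\<in>{0..T}. norm (X \<mu> t w - Xbar \<mu> t w)
      \<le> K * (\<mu> * (1 + 2 * R 0 w) + 2 * (\<mu> powr \<alpha> * (2 * R 0 w)))"
    if "\<mu> \<in> {0<..1}" for \<mu>
    unfolding K_def R_def using that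
    by (intro second_first_order_error(1)[OF _ _ \<open>0 < L\<close> \<open>0 < T\<close> \<open>0 \<le> \<alpha>\<close> lip fbm_AE_regular[OF fbm] sm
          assms(10)[rule_format, OF that] assms(11)[rule_format, OF that]]) auto
  have errn: "AE w in M. \<forall>t\<in>{0..T}. norm (X \<mu> t w - Xbar \<mu> t w)
      \<le> K * (\<mu> * (1 + 2 * R 0 w) + 2 * (\<mu> powr \<alpha> * (2 * R n w + 2 * 2^n / T * R 0 w * \<mu>)))"
    if "\<mu> \<in> {0<..1}" for \<mu> n
    unfolding K_def R_def using that
    by (intro second_first_order_error(2)[OF _ _ \<open>0 < L\<close> \<open>0 < T\<close> \<open>0 \<le> \<alpha>\<close> lip fbm_AE_regular[OF fbm] sm
          assms(10)[rule_format, OF that] assms(11)[rule_format, OF that]]) auto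
  have "\<exists>C>0. \<forall>\<mu>\<in>{0<..1}.
      (\<integral>\<^sup>+ w. (SUP t\<in>{0..T}. ennreal (norm (X \<mu> t w - Xbar \<mu> t w))) \<partial>M) \<le> ennreal (C * \<mu> powr \<alpha>)"
  proof (intro exI conjI ballI)
    show "0 < K * (1 + 6 * A)" using \<open>0 < K\<close> \<open>0 \<le> A\<close> by simp
    fix \<mu> :: real assume \<mu>: "\<mu> \<in> {0<..1}"
    \<comment> \<open>The contributions of order \<open>\<mu>\<close> from the drift and the initial velocity are absorbed by \<open>\<mu> powr \<alpha>\<close>.\<close>
    have "\<mu> \<le> \<mu> powr \<alpha>" using \<mu> \<open>\<alpha> < 1\<close> powr_mono'[of \<alpha> 1 \<mu>] by simp
    have "(\<integral>\<^sup>+ w. (SUP t\<in>{0..T}. ennreal (norm (X \<mu> t w - Xbar \<mu> t w))) \<partial>M)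
        \<le> (\<integral>\<^sup>+ w. ennreal (K * \<mu> + K * (2 * \<mu> + 4 * \<mu> powr \<alpha>) * R 0 w + 0 * R 0 w) \<partial>M)"
    proof (rule nn_integral_mono_AE)
      show "AE w in M. (SUP t\<in>{0..T}. ennreal (norm (X \<mu> t w - Xbar \<mu> t w)))
          \<le> ennreal (K * \<mu> + K * (2 * \<mu> + 4 * \<mu> powr \<alpha>) * R 0 w + 0 * R 0 w)"
        using err0[OF \<mu>]
      proof eventually_elim
        case (elim w)
        have "K * (\<mu> * (1 + 2 * R 0 w) + 2 * (\<mu> powr \<alpha> * (2 * R 0 w)))
            = K * \<mu> + K * (2 * \<mu> + 4 * \<mu> powr \<alpha>) * R 0 w + 0 * R 0 w"
          by (simp add: algebra_simps)
        with elim show ?case by (intro SUP_least ennreal_leI) simp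
      qed
    qed
    also have "\<dots> \<le> ennreal (K * \<mu> + K * (2 * \<mu> + 4 * \<mu> powr \<alpha>) * A + 0 * A)"
      using Rint[of 0] \<open>0 < K\<close> \<open>0 \<le> A\<close> \<mu> by (intro nn_integral_affine_le[OF Rm Rm]) auto
    also have "\<dots> \<le> ennreal (K * (1 + 6 * A) * \<mu> powr \<alpha>)"
    proof (rule ennreal_leI)
      have "K * \<mu> + K * (2 * \<mu> + 4 * \<mu> powr \<alpha>) * A + 0 * A
          \<le> K * \<mu> powr \<alpha> + K * (2 * \<mu> powr \<alpha> + 4 * \<mu> powr \<alpha>) * A + 0 * A"
        using \<open>\<mu> \<le> \<mu> powr \<alpha>\<close> \<open>0 < K\<close> \<open>0 \<le> A\<close> \<mu>
        by (intro add_mono mult_mono order_refl) auto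
      then show "K * \<mu> + K * (2 * \<mu> + 4 * \<mu> powr \<alpha>) * A + 0 * A \<le> K * (1 + 6 * A) * \<mu> powr \<alpha>"
        by (simp add: algebra_simps)
    qed
    finally show "(\<integral>\<^sup>+ w. (SUP t\<in>{0..T}. ennreal (norm (X \<mu> t w - Xbar \<mu> t w))) \<partial>M)
        \<le> ennreal (K * (1 + 6 * A) * \<mu> powr \<alpha>)" .
  qed
  moreover have "((\<lambda>\<mu>. SUP t\<in>{0..T}. \<integral>\<^sup>+ w. ennreal (norm (X \<mu> t w - Xbar \<mu> t w)) \<partial>M) \<longlongrightarrow> 0) (at_right 0)"
    if "\<alpha> = 0"
  proof (rule order_tendstoI)
    \<comment> \<open>The estimate is in fact uniform in \<open>t\<close> along each path, so its expectation bounds every term of the supremum.\<close>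
    have bound: "(SUP t\<in>{0..T}. \<integral>\<^sup>+ w. ennreal (norm (X \<mu> t w - Xbar \<mu> t w)) \<partial>M)
        \<le> ennreal (K * \<mu> + K * (2 * \<mu> + 4 * 2^n / T * \<mu>) * A + 4 * K * (A * q ^ n))"
      if \<mu>: "\<mu> \<in> {0<..1}" for \<mu> n
    proof (rule SUP_least)
      fix t assume t: "t \<in> {0..T}"
      have one: "\<mu> powr \<alpha> = 1" using \<mu> \<open>\<alpha> = 0\<close> by simp
      have "(\<integral>\<^sup>+ w. ennreal (norm (X \<mu> t w - Xbar \<mu> t w)) \<partial>M)
          \<le> (\<integral>\<^sup>+ w. ennreal (K * \<mu> + K * (2 * \<mu> + 4 * 2^n / T * \<mu>) * R 0 w + 4 * K * R n w) \<partial>M)"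
      proof (rule nn_integral_mono_AE)
        show "AE w in M. ennreal (norm (X \<mu> t w - Xbar \<mu> t w))
            \<le> ennreal (K * \<mu> + K * (2 * \<mu> + 4 * 2^n / T * \<mu>) * R 0 w + 4 * K * R n w)"
          using errn[OF \<mu>, of n]
        proof eventually_elim
          case (elim w)
          have "norm (X \<mu> t w - Xbar \<mu> t w)
              \<le> K * (\<mu> * (1 + 2 * R 0 w) + 2 * (2 * R n w + 2 * 2^n / T * R 0 w * \<mu>))"
            using elim t one by simp
          also have "\<dots> = K * \<mu> + K * (2 * \<mu> + 4 * 2^n / T * \<mu>) * R 0 w + 4 * K * R n w"
            by (simp add: algebra_simps)
          finally show ?case by (rule ennreal_leI)
        qed
      qed
      also have "\<dots> \<le> ennreal (K * \<mu> + K * (2 * \<mu> + 4 * 2^n / T * \<mu>) * A + 4 * K * (A * q ^ n))"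
        using Rint[of 0] \<open>0 < K\<close> \<open>0 \<le> A\<close> \<open>0 < q\<close> \<open>0 < T\<close> \<mu>
        by (intro nn_integral_affine_le[OF Rm Rm _ Rint]) auto
      finally show "(\<integral>\<^sup>+ w. ennreal (norm (X \<mu> t w - Xbar \<mu> t w)) \<partial>M) \<le> \<dots>" .
    qed
    fix a :: ennreal assume "0 < a"
    then obtain c where c: "0 < c" "c < a" using dense by blast
    define e where "e = enn2real c"
    have "c < top" using c(2) top_greatest by (rule order.strict_trans2)
    then have e: "0 < e" "ennreal e < a"
      using c by (auto simp: e_def enn2real_positive_iff)
    \<comment> \<open>Fix the level \<open>n\<close> before \<open>\<mu>\<close>: the other terms carry the factor \<open>2 ^ n * \<mu>\<close>.\<close>
    have "(\<lambda>n. 4 * K * (A * q ^ n)) \<longlonglongrightarrow> 4 * K * (A * 0)"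
      using \<open>0 < q\<close> \<open>q < 1\<close> by (intro tendsto_intros LIMSEQ_realpow_zero) auto
    then have "\<forall>\<^sub>F n in sequentially. 4 * K * (A * q ^ n) < e"
      using order_tendstoD(2)[of _ "4 * K * (A * 0)" sequentially e] e by simp
    then obtain n where n: "4 * K * (A * q ^ n) < e" by (auto simp: eventually_sequentially)
    have "((\<lambda>\<mu>. K * \<mu> + K * (2 * \<mu> + 4 * 2^n / T * \<mu>) * A + 4 * K * (A * q ^ n))
        \<longlongrightarrow> K * 0 + K * (2 * 0 + 4 * 2^n / T * 0) * A + 4 * K * (A * q ^ n)) (at_right 0)"
      by (intro tendsto_intros)
    then have "\<forall>\<^sub>F \<mu> in at_right 0. K * \<mu> + K * (2 * \<mu> + 4 * 2^n / T * \<mu>) * A + 4 * K * (A * q ^ n) < e"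
      using n by (intro order_tendstoD(2)) auto
    moreover have "\<forall>\<^sub>F \<mu> in at_right 0. \<mu> \<in> {0<..1::real}"
      unfolding eventually_at_right_field by (rule exI[of _ 1]) auto
    ultimately show "\<forall>\<^sub>F \<mu> in at_right 0.
        (SUP t\<in>{0..T}. \<integral>\<^sup>+ w. ennreal (norm (X \<mu> t w - Xbar \<mu> t w)) \<partial>M) < a"
    proof eventually_elim
      case (elim \<mu>)
      show ?case
        using bound[OF elim(2), of n] ennreal_leI[OF less_imp_le[OF elim(1)]] e(2) by order
    qed
  qed simp
  ultimately show ?thesis by blast
qed

end
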